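(* Let $\alpha$ be an acceptable universal left-r.e. numbering. For every $\Pi_4$ set $A\subseteq\omega$ there exists a recursive function $f$ such that for all $e$: if $e\in A$ then $\alpha_{f(e)}$ is computably random, and if $e\notin A$ then $\alpha_{f(e)}$ is not Schnorr random.
   Context: Reals are infinite binary sequences, identified with numbers in $[0,1]$. A real is left-r.e. if it is the limit of a recursive nondecreasing sequence of rationals. A left-r.e. numbering is a map $e\mapsto\alpha_e=\sum_{x\in\operatorname{dom}\varphi_e}2^{-|x|}$ (with $|x|=\lceil\log(x+1)\rceil$) for some partial recursive $\langle e,x\rangle\mapsto\varphi_e(x)$; it is universal if every left-r.e. real occurs, and acceptable if for every left-r.e. numbering $\beta$ there is a recursive $g$ with $\alpha_{g(e)}=\beta_e$ for all $e$. A martingale is $M:\{0,1\}^*\to\mathbb{R}^+$ with $M(\sigma)=(M(\sigma0)+M(\sigma1))/2$; it succeeds on $X$ if $\limsup M(X\restriction n)=\infty$. $X$ is computably random if no recursive martingale succeeds on it, and Schnorr random if there is no recursive martingale $M$ and unbounded recursive $h$ with $h(n)\le M(X\restriction n)$ for infinitely many $n$. *)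

theory Defs
  imports "HOL-Analysis.Analysis" "HOL-Library.Nat_Bijection"
begin

text \<open>
  Partial recursive functions of one argument, where \<^term>\<open>None\<close> means divergence.
  Functions of several arguments are coded by the pairing function \<^term>\<open>prod_encode\<close>,
  so both projections and pairing are among the closure conditions. In \<open>prec\<close> the argument
  is a coded pair of parameter and recursion variable; \<open>mu\<close> is unbounded search, which
  requires all values before the first zero to be defined.
\<close>

inductive partial_recursive :: "(nat \<Rightarrow> nat option) \<Rightarrow> bool" where
  zero: "partial_recursive (\<lambda>_. Some 0)"
| succ: "partial_recursive (\<lambda>n. Some (Suc n))"
| left: "partial_recursive (\<lambda>n. Some (fst (prod_decode n)))"
| right: "partial_recursive (\<lambda>n. Some (snd (prod_decode n)))"
| pair: "partial_recursive f \<Longrightarrow> partial_recursive g \<Longrightarrow>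
    partial_recursive (\<lambda>n. Option.bind (f n) (\<lambda>a. Option.bind (g n) (\<lambda>b. Some (prod_encode (a, b)))))"
| comp: "partial_recursive f \<Longrightarrow> partial_recursive g \<Longrightarrow>
    partial_recursive (\<lambda>n. Option.bind (g n) f)"
| prec: "partial_recursive f \<Longrightarrow> partial_recursive g \<Longrightarrow>
    partial_recursive (\<lambda>n. rec_nat (f (fst (prod_decode n)))
      (\<lambda>y r. Option.bind r (\<lambda>i. g (prod_encode (fst (prod_decode n), prod_encode (y, i)))))
      (snd (prod_decode n)))"
| mu: "partial_recursive f \<Longrightarrow>
    partial_recursive (\<lambda>a.
      if \<exists>m. f (prod_encode (a, m)) = Some 0 \<and> (\<forall>k<m. f (prod_encode (a, k)) \<noteq> None)
      then Some (LEAST m. f (prod_encode (a, m)) = Some 0) else None)"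

definition recursive :: "(nat \<Rightarrow> nat) \<Rightarrow> bool" where
  "recursive f \<longleftrightarrow> partial_recursive (\<lambda>n. Some (f n))"

definition recursive_set :: "nat set \<Rightarrow> bool" where
  "recursive_set A \<longleftrightarrow> recursive (\<lambda>n. of_bool (n \<in> A))"

fun Sigma_set :: "nat \<Rightarrow> nat set \<Rightarrow> bool" and Pi_set :: "nat \<Rightarrow> nat set \<Rightarrow> bool" where
  "Sigma_set 0 A = recursive_set A"
| "Pi_set 0 A = recursive_set A"
| "Sigma_set (Suc n) A = (\<exists>B. Pi_set n B \<and> A = {x. \<exists>y. prod_encode (x, y) \<in> B})"
| "Pi_set (Suc n) A = (\<exists>B. Sigma_set n B \<and> A = {x. \<forall>y. prod_encode (x, y) \<in> B})"

definition recursive_rat_seq :: "(nat \<Rightarrow> rat) \<Rightarrow> bool" where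
  "recursive_rat_seq q \<longleftrightarrow> (\<exists>a b c. recursive a \<and> recursive b \<and> recursive c \<and>
     (\<forall>n. q n = (of_nat (a n) - of_nat (b n)) / of_nat (Suc (c n))))"


definition left_re :: "real \<Rightarrow> bool" where
  "left_re r \<longleftrightarrow> r \<in> {0..1} \<and>
     (\<exists>q. recursive_rat_seq q \<and> incseq q \<and> (\<lambda>n. real_of_rat (q n)) \<longlonglongrightarrow> r)"

definition len :: "nat \<Rightarrow> nat" where
  "len x = nat \<lceil>log 2 (real x + 1)\<rceil>"

text \<open>
  The sum of \<open>1 / 2 ^ len x\<close> over all \<open>x\<close> diverges. Since reals are numbers in the unit
  interval, only those \<open>\<phi>\<close> qualify for which every sum converges to a number in it.
\<close>

definition left_re_numbering :: "(nat \<Rightarrow> real) \<Rightarrow> bool" where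
  "left_re_numbering \<alpha> \<longleftrightarrow> (\<exists>\<phi>. partial_recursive \<phi> \<and>
     (\<forall>e. \<alpha> e \<in> {0..1} \<and>
       ((\<lambda>x. 1 / 2 ^ len x) has_sum \<alpha> e) {x. \<phi> (prod_encode (e, x)) \<noteq> None}))"

definition universal_numbering :: "(nat \<Rightarrow> real) \<Rightarrow> bool" where
  "universal_numbering \<alpha> \<longleftrightarrow> (\<forall>r. left_re r \<longrightarrow> (\<exists>e. \<alpha> e = r))"

definition acceptable_numbering :: "(nat \<Rightarrow> real) \<Rightarrow> bool" where
  "acceptable_numbering \<alpha> \<longleftrightarrow>
     (\<forall>\<beta>. left_re_numbering \<beta> \<longrightarrow> (\<exists>g. recursive g \<and> (\<forall>e. \<alpha> (g e) = \<beta> e)))"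


definition restr :: "(nat \<Rightarrow> bool) \<Rightarrow> nat \<Rightarrow> bool list" where
  "restr X n = map X [0..<n]"

definition martingale :: "(bool list \<Rightarrow> real) \<Rightarrow> bool" where
  "martingale M \<longleftrightarrow> (\<forall>\<sigma>. M \<sigma> \<ge> 0 \<and> M \<sigma> = (M (\<sigma> @ [False]) + M (\<sigma> @ [True])) / 2)"

definition string_code :: "bool list \<Rightarrow> nat" where
  "string_code \<sigma> = list_encode (map of_bool \<sigma>)"

text \<open>Recursiveness of a real-valued function: uniformly computable rational approximations
  with error at most \<open>1 / 2 ^ k\<close>.\<close>

definition recursive_martingale :: "(bool list \<Rightarrow> real) \<Rightarrow> bool" where
  "recursive_martingale M \<longleftrightarrow> martingale M \<and>
     (\<exists>q. recursive_rat_seq q \<and>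
       (\<forall>\<sigma> k. \<bar>M \<sigma> - real_of_rat (q (prod_encode (string_code \<sigma>, k)))\<bar> \<le> 1 / 2 ^ k))"

definition succeeds_on :: "(bool list \<Rightarrow> real) \<Rightarrow> (nat \<Rightarrow> bool) \<Rightarrow> bool" where
  "succeeds_on M X \<longleftrightarrow> limsup (\<lambda>n. ereal (M (restr X n))) = \<infinity>"

definition computably_random :: "(nat \<Rightarrow> bool) \<Rightarrow> bool" where
  "computably_random X \<longleftrightarrow> \<not> (\<exists>M. recursive_martingale M \<and> succeeds_on M X)"

text \<open>The bound \<open>h\<close> must be nondecreasing: otherwise it could vanish infinitely often, and no
  sequence would be Schnorr random.\<close>

definition schnorr_random :: "(nat \<Rightarrow> bool) \<Rightarrow> bool" where
  "schnorr_random X \<longleftrightarrow> \<not> (\<exists>M h. recursive_martingale M \<and>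
     recursive h \<and> mono h \<and> (\<forall>b. \<exists>n. b \<le> h n) \<and>
     infinite {n. real (h n) \<le> M (restr X n)})"

definition real_of_seq :: "(nat \<Rightarrow> bool) \<Rightarrow> real" where
  "real_of_seq X = (\<Sum>n. of_bool (X n) / 2 ^ Suc n)"

text \<open>A number is random if one of its binary expansions is. Only dyadic rationals have two
  expansions, and neither of those is random in either sense.\<close>

definition computably_random_real :: "real \<Rightarrow> bool" where
  "computably_random_real r \<longleftrightarrow> (\<exists>X. real_of_seq X = r \<and> computably_random X)"

definition schnorr_random_real :: "real \<Rightarrow> bool" where
  "schnorr_random_real r \<longleftrightarrow> (\<exists>X. real_of_seq X = r \<and> schnorr_random X)"

end

theory Submission imports Defs begin

text \<open>
  Write \<open>e \<in> A\<close> as \<open>\<forall>n. \<exists>k. P e n k\<close> with \<open>P\<close> a \<open>\<Pi>\<^sub>2\<close> predicate. A guessing construction, in which an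
  index may act on an argument only if every smaller one has either converged there or made no recent
  progress, yields functions \<open>g e\<close>, uniformly approximable from below, such that \<open>g e\<close> dominates all
  recursive functions if \<open>e \<in> A\<close>, and is infinitely often below some recursive function otherwise.

  In the block of positions from \<open>2 ^ m\<close> to \<open>2 ^ Suc m\<close>, count a supermartingale if it has been seen to
  be one within \<open>g e m\<close> steps, and let \<open>X e\<close> be the leftmost sequence on which the weighted sum of the
  counted ones stays bounded. As \<open>g e m\<close> increases, more of them count and \<open>X e\<close> moves to the right;
  so its value is left-r.e. uniformly in \<open>e\<close>. If \<open>g e\<close> dominates all recursive functions then every
  recursive martingale is counted from some block on, under a suitable index, and is bounded on \<open>X e\<close>.
  If \<open>g e m \<le> p m\<close> for infinitely many \<open>m\<close> and a recursive \<open>p\<close>, then in each of those blocks \<open>X e\<close>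
  follows one of the \<open>2 ^ Suc m\<close> continuations that correspond to subsets of the supermartingales seen
  within \<open>p m\<close> steps, and a recursive martingale betting on these succeeds fast.

  No universal machine is needed: a universal left-r.e. numbering enumerates all recursive functions,
  coded as computable reals.
\<close>

section \<open>Recursive functions\<close>

abbreviation pfst :: "nat \<Rightarrow> nat" where "pfst z \<equiv> fst (prod_decode z)"
abbreviation psnd :: "nat \<Rightarrow> nat" where "psnd z \<equiv> snd (prod_decode z)"
abbreviation pe :: "nat \<Rightarrow> nat \<Rightarrow> nat" where "pe a b \<equiv> prod_encode (a, b)"

definition decidable :: "(nat \<Rightarrow> bool) \<Rightarrow> bool" where
  "decidable P \<longleftrightarrow> recursive (\<lambda>x. of_bool (P x))"

named_theorems rec_intros

lemma recursive_comp: "recursive f \<Longrightarrow> recursive g \<Longrightarrow> recursive (\<lambda>x. f (g x))"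
  unfolding recursive_def using partial_recursive.comp[of "\<lambda>x. Some (f x)" "\<lambda>x. Some (g x)"] by simp

lemma decidable_comp: "decidable P \<Longrightarrow> recursive g \<Longrightarrow> decidable (\<lambda>x. P (g x))"
  unfolding decidable_def by (rule recursive_comp[of "\<lambda>x. of_bool (P x)"])

lemma recursive_pair [rec_intros]:
  "recursive f \<Longrightarrow> recursive g \<Longrightarrow> recursive (\<lambda>x. pe (f x) (g x))"
  unfolding recursive_def
  using partial_recursive.pair[of "\<lambda>x. Some (f x)" "\<lambda>x. Some (g x)"] by simp

lemma recursive_fst [rec_intros]: "recursive f \<Longrightarrow> recursive (\<lambda>x. pfst (f x))"
  by (rule recursive_comp[of pfst]) (simp_all add: recursive_def partial_recursive.left)

lemma recursive_snd [rec_intros]: "recursive f \<Longrightarrow> recursive (\<lambda>x. psnd (f x))"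
  by (rule recursive_comp[of psnd]) (simp_all add: recursive_def partial_recursive.right)

lemma recursive_id [rec_intros]: "recursive (\<lambda>x. x)"
proof -
  have "recursive pfst" "recursive psnd"
    by (simp_all add: recursive_def partial_recursive.left partial_recursive.right)
  from recursive_pair[OF this] show ?thesis by simp
qed

lemma recursive_Suc [rec_intros]: "recursive f \<Longrightarrow> recursive (\<lambda>x. Suc (f x))"
  by (rule recursive_comp[of Suc]) (simp_all add: recursive_def partial_recursive.succ)

lemma recursive_const [rec_intros]: "recursive (\<lambda>x. c)"
proof (induction c)
  case 0
  show ?case by (simp add: recursive_def partial_recursive.zero)
qed (rule recursive_Suc)

lemma recursive_rec_nat [rec_intros]:
  assumes f: "recursive f"
    and g: "recursive (\<lambda>z. g (pfst z) (pfst (psnd z)) (psnd (psnd z)))"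
    and h: "recursive h"
  shows "recursive (\<lambda>x. rec_nat (f x) (\<lambda>y r. g x y r) (h x))"
proof -
  let ?G = "\<lambda>z. g (pfst z) (pfst (psnd z)) (psnd (psnd z))"
  have eq: "rec_nat (Some (f x)) (\<lambda>y r. Option.bind r (\<lambda>i. Some (?G (pe x (pe y i))))) n
      = Some (rec_nat (f x) (g x) n)" for x n
    by (induction n) auto
  have "recursive (\<lambda>z. rec_nat (f (pfst z)) (g (pfst z)) (psnd z))"
    using partial_recursive.prec[OF f[unfolded recursive_def] g[unfolded recursive_def]]
    unfolding eq recursive_def .
  from recursive_comp[OF this recursive_pair[OF recursive_id h]] show ?thesis by simp
qed

lemma recursive_add [rec_intros]:
  assumes "recursive f" "recursive g" shows "recursive (\<lambda>x. f x + g x)"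
proof -
  have "rec_nat a (\<lambda>y r. Suc r) n = a + n" for a n :: nat by (induction n) auto
  then show ?thesis
    using recursive_rec_nat[of f "\<lambda>x y r. Suc r" g] assms by (simp add: rec_intros)
qed

lemma recursive_mult [rec_intros]:
  assumes "recursive f" "recursive g" shows "recursive (\<lambda>x. f x * g x)"
proof -
  have eq: "rec_nat 0 (\<lambda>y r. a + r) n = a * n" for a n :: nat by (induction n) auto
  have "recursive (\<lambda>x. rec_nat 0 (\<lambda>y r. f x + r) (g x))"
    by (intro rec_intros assms assms[THEN recursive_comp])
  then show ?thesis by (simp add: eq)
qed

lemma recursive_power [rec_intros]:
  assumes "recursive f" "recursive g" shows "recursive (\<lambda>x. f x ^ g x)"
proof -
  have eq: "rec_nat (Suc 0) (\<lambda>y r. a * r) n = a ^ n" for a n :: nat by (induction n) auto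
  have "recursive (\<lambda>x. rec_nat (Suc 0) (\<lambda>y r. f x * r) (g x))"
    by (intro rec_intros assms assms[THEN recursive_comp])
  then show ?thesis by (simp add: eq)
qed

lemma recursive_diff [rec_intros]:
  assumes "recursive f" "recursive g" shows "recursive (\<lambda>x. f x - g x)"
proof -
  have pred: "rec_nat 0 (\<lambda>y r. y) n = n - 1" for n :: nat by (cases n) auto
  have "recursive (\<lambda>x. rec_nat 0 (\<lambda>y r. y) x)" by (intro rec_intros)
  then have P: "recursive (\<lambda>n. n - 1)" by (simp add: pred)
  have eq: "rec_nat a (\<lambda>y r. r - 1) n = a - n" for a n :: nat by (induction n) auto
  have "recursive (\<lambda>x. rec_nat (f x) (\<lambda>y r. r - 1) (g x))"
    by (intro rec_intros assms P[THEN recursive_comp])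
  then show ?thesis by (simp only: eq)
qed

lemma recursive_sum [rec_intros]:
  assumes "recursive (\<lambda>z. f (pfst z) (psnd z))" "recursive h"
  shows "recursive (\<lambda>x. \<Sum>i<h x. f x i)"
proof -
  have eq: "rec_nat 0 (\<lambda>y r. r + f x y) n = (\<Sum>i<n. f x i)" for x n
    by (induction n) auto
  have "recursive (\<lambda>x. rec_nat 0 (\<lambda>y r. r + f (pfst (pe x y)) (psnd (pe x y))) (h x))"
    by (intro rec_intros assms assms[THEN recursive_comp])
  then show ?thesis by (simp add: eq)
qed

lemma recursive_sum_atMost [rec_intros]:
  assumes "recursive (\<lambda>z. f (pfst z) (psnd z))" "recursive h"
  shows "recursive (\<lambda>x. \<Sum>i\<le>h x. f x i)"
  unfolding lessThan_Suc_atMost[symmetric] by (intro rec_intros assms)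

lemma recursive_of_bool [rec_intros]: "decidable P \<Longrightarrow> recursive (\<lambda>x. of_bool (P x))"
  by (simp add: decidable_def)

lemma recursive_if [rec_intros]:
  assumes "decidable P" "recursive f" "recursive g"
  shows "recursive (\<lambda>x. if P x then f x else g x)"
proof -
  have "recursive (\<lambda>x. of_bool (P x) * f x + (1 - of_bool (P x)) * g x)"
    by (intro rec_intros assms)
  moreover have "(\<lambda>x. of_bool (P x) * f x + (1 - of_bool (P x)) * g x) = (\<lambda>x. if P x then f x else g x)"
    by auto
  ultimately show ?thesis by simp
qed

lemma decidable_eq [rec_intros]:
  assumes "recursive f" "recursive g" shows "decidable (\<lambda>x. f x = g x)"
proof -
  have "recursive (\<lambda>x. 1 - ((f x - g x) + (g x - f x)))" by (intro rec_intros assms)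
  moreover have "(\<lambda>x. 1 - ((f x - g x) + (g x - f x))) = (\<lambda>x. of_bool (f x = g x))"
    by (auto simp: fun_eq_iff)
  ultimately show ?thesis by (simp add: decidable_def)
qed

lemma decidable_not [rec_intros]:
  assumes "decidable P" shows "decidable (\<lambda>x. \<not> P x)"
proof -
  have "recursive (\<lambda>x. 1 - of_bool (P x))" by (intro rec_intros assms)
  moreover have "(\<lambda>x. 1 - of_bool (P x)) = (\<lambda>x. of_bool (\<not> P x) :: nat)"
    by (auto simp: fun_eq_iff)
  ultimately show ?thesis by (simp add: decidable_def)
qed

lemma decidable_conj [rec_intros]:
  assumes "decidable P" "decidable Q" shows "decidable (\<lambda>x. P x \<and> Q x)"
  using recursive_mult[OF assms[unfolded decidable_def]] by (simp add: decidable_def of_bool_conj)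

lemma decidable_disj [rec_intros]:
  assumes "decidable P" "decidable Q" shows "decidable (\<lambda>x. P x \<or> Q x)"
proof -
  have "decidable (\<lambda>x. \<not> (\<not> P x \<and> \<not> Q x))" by (intro decidable_not decidable_conj assms)
  then show ?thesis by simp
qed

lemma decidable_imp [rec_intros]:
  assumes "decidable P" "decidable Q" shows "decidable (\<lambda>x. P x \<longrightarrow> Q x)"
  unfolding imp_conv_disj by (intro rec_intros assms)

lemma decidable_le [rec_intros]:
  assumes "recursive f" "recursive g" shows "decidable (\<lambda>x. f x \<le> g x)"
proof -
  have "decidable (\<lambda>x. f x - g x = 0)" by (intro rec_intros assms)
  then show ?thesis by simp
qed

lemma decidable_less [rec_intros]:
  assumes "recursive f" "recursive g" shows "decidable (\<lambda>x. f x < g x)"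
  unfolding not_le[symmetric] by (intro rec_intros assms)

lemma decidable_all_less [rec_intros]:
  assumes "decidable (\<lambda>z. P (pfst z) (psnd z))" "recursive h"
  shows "decidable (\<lambda>x. \<forall>i<h x. P x i)"
proof -
  have "decidable (\<lambda>x. (\<Sum>i<h x. of_bool (\<not> P x i)) = (0::nat))" by (intro rec_intros assms)
  moreover have "((\<Sum>i<h x. of_bool (\<not> P x i)) = (0::nat)) = (\<forall>i<h x. P x i)" for x
    by auto
  ultimately show ?thesis by simp
qed

lemma decidable_all_le [rec_intros]:
  assumes "decidable (\<lambda>z. P (pfst z) (psnd z))" "recursive h"
  shows "decidable (\<lambda>x. \<forall>i\<le>h x. P x i)"
  unfolding less_Suc_eq_le[symmetric] by (intro rec_intros assms)

lemma decidable_ex_less [rec_intros]: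
  assumes "decidable (\<lambda>z. P (pfst z) (psnd z))" "recursive h"
  shows "decidable (\<lambda>x. \<exists>i<h x. P x i)"
proof -
  have "decidable (\<lambda>x. \<not> (\<forall>i<h x. \<not> P x i))" by (intro rec_intros assms)
  then show ?thesis by simp
qed

lemma decidable_ex_le [rec_intros]:
  assumes "decidable (\<lambda>z. P (pfst z) (psnd z))" "recursive h"
  shows "decidable (\<lambda>x. \<exists>i\<le>h x. P x i)"
  unfolding less_Suc_eq_le[symmetric] by (intro rec_intros assms)

lemma recursive_Least:
  assumes "decidable (\<lambda>z. P (pfst z) (psnd z))" and ex: "\<And>x. \<exists>m. P x m"
  shows "recursive (\<lambda>x. LEAST m. P x m)"
proof -
  have "recursive (\<lambda>z. of_bool (\<not> P (pfst z) (psnd z)))" by (intro rec_intros assms(1))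
  from partial_recursive.mu[OF this[unfolded recursive_def]]
  show ?thesis unfolding recursive_def using ex by simp
qed

text \<open>The disjunct \<open>h x \<le> m\<close> makes the search total without an existence
  premise; \<open>h x\<close> is the result when no smaller \<open>m\<close> satisfies
  \<open>P\<close>.\<close>

lemma recursive_Least_bounded [rec_intros]:
  assumes "decidable (\<lambda>z. P (pfst z) (psnd z))" "recursive h"
  shows "recursive (\<lambda>x. LEAST m. P x m \<or> h x \<le> m)"
  by (rule recursive_Least) (intro rec_intros assms assms(2)[THEN recursive_comp], blast)

lemma recursive_div [rec_intros]:
  assumes "recursive f" "recursive g" shows "recursive (\<lambda>x. f x div g x)"
proof -
  have eq: "(if b = 0 then 0 else LEAST m. a < Suc m * b \<or> a \<le> m) = a div b" for a b :: nat
  proof (cases "b = 0")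
    case False
    have "(LEAST m. a < Suc m * b \<or> a \<le> m) = a div b"
    proof (rule Least_equality)
      show "a < Suc (a div b) * b \<or> a \<le> a div b"
        using False by (metis dividend_less_div_times mult_Suc not_gr0 mult.commute)
      fix m assume "a < Suc m * b \<or> a \<le> m"
      then show "a div b \<le> m"
      proof
        assume "a < Suc m * b"
        then show ?thesis using False by (metis less_Suc_eq_le less_mult_imp_div_less)
      next
        assume "a \<le> m" then show ?thesis using div_le_dividend le_trans by blast
      qed
    qed
    then show ?thesis using False by simp
  qed simp
  have "recursive (\<lambda>x. if g x = 0 then 0 else LEAST m. f x < Suc m * g x \<or> f x \<le> m)"
    by (intro rec_intros assms assms[THEN recursive_comp])
  then show ?thesis by (simp only: eq)
qed

lemma recursive_mod [rec_intros]:
  assumes "recursive f" "recursive g" shows "recursive (\<lambda>x. f x mod g x)"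
  unfolding modulo_nat_def by (intro rec_intros assms)

lemma decidable_even [rec_intros]: "recursive f \<Longrightarrow> decidable (\<lambda>x. even (f x))"
  unfolding even_iff_mod_2_eq_zero by (intro rec_intros)

lemma recursive_min [rec_intros]:
  assumes "recursive f" "recursive g" shows "recursive (\<lambda>x. min (f x) (g x))"
  unfolding min_def by (intro rec_intros assms)

text \<open>The value \<open>Suc y\<close> at stage \<open>t\<close> says that the computation has halted with output \<open>y\<close>.\<close>

definition stages :: "(nat \<Rightarrow> nat option) \<Rightarrow> (nat \<Rightarrow> nat \<Rightarrow> nat) \<Rightarrow> bool" where
  "stages f F \<longleftrightarrow> recursive (\<lambda>z. F (pfst z) (psnd z)) \<and>
    (\<forall>x t. F x t \<noteq> 0 \<longrightarrow> f x = Some (F x t - 1)) \<and>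
    (\<forall>x y. f x = Some y \<longrightarrow> (\<exists>t0. \<forall>t\<ge>t0. F x t = Suc y))"

lemma stages_recursive:
  assumes "stages f F" "recursive a" "recursive b"
  shows "recursive (\<lambda>x. F (a x) (b x))"
proof -
  have "recursive (\<lambda>z. F (pfst z) (psnd z))" using assms(1) unfolding stages_def by blast
  from recursive_comp[OF this recursive_pair[OF assms(2,3)]] show ?thesis by simp
qed

lemma stages_sound: "stages f F \<Longrightarrow> F x t \<noteq> 0 \<Longrightarrow> f x = Some (F x t - 1)"
  unfolding stages_def by blast

lemma stages_complete: "stages f F \<Longrightarrow> f x = Some y \<Longrightarrow> \<exists>t0. \<forall>t\<ge>t0. F x t = Suc y"
  unfolding stages_def by blast

text \<open>All subcomputations are run at the same stage \<open>t\<close>. A halting computation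
  uses only finitely many of them, so from some stage on all have stabilised.\<close>

lemma partial_recursive_stages: "partial_recursive f \<Longrightarrow> \<exists>F. stages f F"
proof (induction rule: partial_recursive.induct)
  case zero
  show ?case by (rule exI[of _ "\<lambda>x t. 1"]) (auto simp: stages_def intro!: rec_intros)
next
  case succ
  show ?case by (rule exI[of _ "\<lambda>x t. Suc (Suc x)"]) (auto simp: stages_def intro!: rec_intros)
next
  case left
  show ?case by (rule exI[of _ "\<lambda>x t. Suc (pfst x)"]) (auto simp: stages_def intro!: rec_intros)
next
  case right
  show ?case by (rule exI[of _ "\<lambda>x t. Suc (psnd x)"]) (auto simp: stages_def intro!: rec_intros)
next
  case (pair f g)
  then obtain F G where FG: "stages f F" "stages g G" by blast
  note F = stages_recursive[OF FG(1)] stages_sound[OF FG(1)] stages_complete[OF FG(1)]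
  note G = stages_recursive[OF FG(2)] stages_sound[OF FG(2)] stages_complete[OF FG(2)]
  let ?H = "\<lambda>x t. if F x t = 0 \<or> G x t = 0 then 0 else Suc (pe (F x t - 1) (G x t - 1))"
  show ?case
  proof (rule exI[of _ ?H], unfold stages_def, intro conjI allI impI)
    show "recursive (\<lambda>z. ?H (pfst z) (psnd z))" by (intro rec_intros F(1) G(1))
  next
    fix x t assume "?H x t \<noteq> 0"
    then show "Option.bind (f x) (\<lambda>a. Option.bind (g x) (\<lambda>b. Some (pe a b))) = Some (?H x t - 1)"
      using F(2)[of x t] G(2)[of x t] by (auto split: if_splits)
  next
    fix x y assume "Option.bind (f x) (\<lambda>a. Option.bind (g x) (\<lambda>b. Some (pe a b))) = Some y"
    then obtain a b where ab: "f x = Some a" "g x = Some b" "y = pe a b"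
      by (auto simp: Option.bind_eq_Some_conv)
    obtain s t where "\<forall>r\<ge>s. F x r = Suc a" "\<forall>r\<ge>t. G x r = Suc b" using F(3) G(3) ab by meson
    then have "\<forall>r\<ge>max s t. ?H x r = Suc y" using ab by simp
    then show "\<exists>t0. \<forall>r\<ge>t0. ?H x r = Suc y" by blast
  qed
next
  case (comp f g)
  then obtain F G where FG: "stages f F" "stages g G" by blast
  note F = stages_recursive[OF FG(1)] stages_sound[OF FG(1)] stages_complete[OF FG(1)]
  note G = stages_recursive[OF FG(2)] stages_sound[OF FG(2)] stages_complete[OF FG(2)]
  let ?H = "\<lambda>x t. if G x t = 0 then 0 else F (G x t - 1) t"
  show ?case
  proof (rule exI[of _ ?H], unfold stages_def, intro conjI allI impI)
    show "recursive (\<lambda>z. ?H (pfst z) (psnd z))" by (intro rec_intros F(1) G(1))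
  next
    fix x t assume "?H x t \<noteq> 0"
    then show "Option.bind (g x) f = Some (?H x t - 1)"
      using F(2)[of "G x t - 1" t] G(2)[of x t] by (auto split: if_splits)
  next
    fix x y assume "Option.bind (g x) f = Some y"
    then obtain a where a: "g x = Some a" "f a = Some y"
      by (auto simp: Option.bind_eq_Some_conv)
    obtain s t where "\<forall>r\<ge>s. F a r = Suc y" "\<forall>r\<ge>t. G x r = Suc a" using F(3) G(3) a by meson
    then have "\<forall>r\<ge>max s t. ?H x r = Suc y" by simp
    then show "\<exists>t0. \<forall>r\<ge>t0. ?H x r = Suc y" by blast
  qed
next
  case (prec f g)
  then obtain F G where FG: "stages f F" "stages g G" by blast
  note F = stages_recursive[OF FG(1)] stages_sound[OF FG(1)] stages_complete[OF FG(1)]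
  note G = stages_recursive[OF FG(2)] stages_sound[OF FG(2)] stages_complete[OF FG(2)]
  define H where "H a n t = rec_nat (F a t)
    (\<lambda>y r. if r = 0 then 0 else G (pe a (pe y (r - 1))) t) n" for a n t
  let ?h = "\<lambda>a n. rec_nat (f a) (\<lambda>y r. Option.bind r (\<lambda>i. g (pe a (pe y i)))) n"
  have H0: "H a 0 t = F a t"
    and HS: "H a (Suc n) t = (if H a n t = 0 then 0 else G (pe a (pe n (H a n t - 1))) t)" for a n t
    by (simp_all add: H_def)
  have sound: "H a n t \<noteq> 0 \<Longrightarrow> ?h a n = Some (H a n t - 1)" for a n t
  proof (induction n)
    case 0 then show ?case using F(2)[of a t] by (simp add: H0)
  next
    case (Suc n)
    then show ?case using G(2)[of "pe a (pe n (H a n t - 1))" t] by (auto simp: HS split: if_splits)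
  qed
  have compl: "?h a n = Some y \<Longrightarrow> \<exists>t0. \<forall>t\<ge>t0. H a n t = Suc y" for a n y
  proof (induction n arbitrary: y)
    case 0 then show ?case using F(3)[of a y] by (simp add: H0)
  next
    case (Suc n)
    then obtain i where i: "?h a n = Some i" "g (pe a (pe n i)) = Some y"
      by (auto simp: Option.bind_eq_Some_conv)
    obtain s t where "\<forall>r\<ge>s. H a n r = Suc i" "\<forall>r\<ge>t. G (pe a (pe n i)) r = Suc y"
      using Suc.IH[OF i(1)] G(3)[OF i(2)] by blast
    then have "\<forall>r\<ge>max s t. H a (Suc n) r = Suc y" by (simp add: HS)
    then show ?case by blast
  qed
  show ?case
  proof (rule exI[of _ "\<lambda>x t. H (pfst x) (psnd x) t"], unfold stages_def, intro conjI allI impI)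
    show "recursive (\<lambda>z. H (pfst (pfst z)) (psnd (pfst z)) (psnd z))"
      unfolding H_def by (intro rec_intros F(1) G(1))
  next
    fix x t assume "H (pfst x) (psnd x) t \<noteq> 0"
    then show "?h (pfst x) (psnd x) = Some (H (pfst x) (psnd x) t - 1)" by (rule sound)
  next
    fix x y assume "?h (pfst x) (psnd x) = Some y"
    then show "\<exists>t0. \<forall>t\<ge>t0. H (pfst x) (psnd x) t = Suc y" by (rule compl)
  qed
next
  case (mu f)
  then obtain F where FG: "stages f F" by blast
  note F = stages_recursive[OF FG] stages_sound[OF FG] stages_complete[OF FG]
  \<comment> \<open>At stage \<open>t\<close> the search accepts \<open>m\<close> only if output 0
    has been seen at \<open>m\<close> and some output at each smaller argument; a value of
    \<open>b a t\<close> beyond \<open>t\<close> means that none was found.\<close>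
  define P where "P a t m \<longleftrightarrow> F (pe a m) t = 1 \<and> (\<forall>k<m. F (pe a k) t \<noteq> 0)" for a t m
  define b where "b a t = (LEAST m. P a t m \<or> Suc t \<le> m)" for a t
  let ?H = "\<lambda>a t. if b a t < Suc t then Suc (b a t) else 0"
  let ?h = "\<lambda>a. if \<exists>m. f (pe a m) = Some 0 \<and> (\<forall>k<m. f (pe a k) \<noteq> None)
      then Some (LEAST m. f (pe a m) = Some 0) else None"
  have h: "?h a = Some m" if "f (pe a m) = Some 0" "\<And>k. k < m \<Longrightarrow> f (pe a k) \<noteq> None \<and> f (pe a k) \<noteq> Some 0"
    for a m
  proof -
    have "(LEAST m. f (pe a m) = Some 0) = m"
      using that by (intro Least_equality) (auto simp: not_less[symmetric])
    then show ?thesis using that by auto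
  qed
  have sound: "?h a = Some (b a t)" if "b a t < Suc t" for a t
  proof (rule h)
    have "P a t (b a t) \<or> Suc t \<le> b a t" unfolding b_def by (rule LeastI_ex) auto
    then have P: "P a t (b a t)" using that by simp
    then show "f (pe a (b a t)) = Some 0" using F(2)[of "pe a (b a t)" t] by (simp add: P_def)
    fix k assume k: "k < b a t"
    then have ne: "F (pe a k) t \<noteq> 0" using P by (simp add: P_def)
    have "\<not> P a t k" using not_less_Least[of k "\<lambda>m. P a t m \<or> Suc t \<le> m"] k by (simp add: b_def)
    then have "F (pe a k) t \<noteq> 1" using P k unfolding P_def by (metis less_trans)
    then show "f (pe a k) \<noteq> None \<and> f (pe a k) \<noteq> Some 0" using F(2)[OF ne] ne by auto
  qed
  have compl: "\<exists>t0. \<forall>t\<ge>t0. ?H a t = Suc y" if "?h a = Some y" for a y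
  proof -
    obtain m0 where m0: "f (pe a m0) = Some 0" "\<forall>k<m0. f (pe a k) \<noteq> None"
      and y: "y = (LEAST m. f (pe a m) = Some 0)" using \<open>?h a = Some y\<close> by (auto split: if_splits)
    have y1: "f (pe a y) = Some 0" "y \<le> m0" unfolding y using m0(1)
      by (auto intro: LeastI Least_le)
    have y2: "f (pe a k) \<noteq> None" "f (pe a k) \<noteq> Some 0" if "k < y" for k
      using m0(2) that y1(2) not_less_Least[of k "\<lambda>m. f (pe a m) = Some 0"] by (auto simp: y)
    have "\<exists>t0. \<forall>t\<ge>t0. F (pe a k) t = Suc (the (f (pe a k)))" if "k \<le> y" for k
      using F(3)[of "pe a k"] y1(1) y2[of k] that by (cases "k = y") auto
    then obtain T where T: "\<And>k t. k \<le> y \<Longrightarrow> T k \<le> t \<Longrightarrow> F (pe a k) t = Suc (the (f (pe a k)))"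
      by metis
    \<comment> \<open>Past the sum of the halting stages every relevant value is known; the summand
      \<open>y\<close> keeps the answer within the search bound.\<close>
    have "?H a t = Suc y" if t: "t \<ge> y + (\<Sum>k\<le>y. T k)" for t
    proof -
      have Tk: "T k \<le> t" if "k \<le> y" for k
        using member_le_sum[of k "{..y}" T] that t by simp
      have "b a t = y" unfolding b_def
      proof (rule Least_equality)
        show "P a t y \<or> Suc t \<le> y" using T Tk y1 by (auto simp: P_def)
        fix m assume "P a t m \<or> Suc t \<le> m"
        then show "y \<le> m"
        proof
          assume "P a t m"
          then have "f (pe a m) = Some 0" using F(2)[of "pe a m" t] by (simp add: P_def)
          then show ?thesis using y2[of m] by (meson not_less)
        qed (use t in simp)
      qed
      then show ?thesis using t by simp
    qed
    then show ?thesis by blast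
  qed
  show ?case
  proof (rule exI[of _ ?H], unfold stages_def, intro conjI allI impI)
    have *: "recursive (\<lambda>z. b (pfst z) (psnd z))"
      unfolding b_def P_def by (intro rec_intros F(1))
    show "recursive (\<lambda>z. ?H (pfst z) (psnd z))" by (intro rec_intros *)
  next
    fix x t assume "?H x t \<noteq> 0"
    then have "b x t < Suc t" by (auto split: if_splits)
    then show "?h x = Some (?H x t - 1)" using sound[of x t] by simp
  next
    fix x y assume "?h x = Some y"
    then show "\<exists>t0. \<forall>t\<ge>t0. ?H x t = Suc y" by (rule compl)
  qed
qed

section \<open>Enumerating the recursive functions by a universal numbering\<close>

lemma len_le_iff: "len x \<le> k \<longleftrightarrow> x < 2 ^ k"
proof -
  have "len x \<le> k \<longleftrightarrow> \<lceil>log 2 (real x + 1)\<rceil> \<le> int k" by (simp add: len_def nat_le_iff)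
  also have "\<dots> \<longleftrightarrow> log 2 (real x + 1) \<le> real k" by (simp add: ceiling_le_iff)
  also have "\<dots> \<longleftrightarrow> real x + 1 \<le> 2 powr real k" by (simp add: log_le_iff)
  also have "\<dots> \<longleftrightarrow> real (x + 1) \<le> real (2 ^ k)" by (simp add: powr_realpow add.commute)
  also have "\<dots> \<longleftrightarrow> x + 1 \<le> 2 ^ k" by (simp only: of_nat_le_iff)
  finally show ?thesis by auto
qed

lemma len_eq_Least: "len x = (LEAST k. x < 2 ^ k)"
  using len_le_iff[of x] by (intro Least_equality[symmetric]) blast+

lemma len_le_self: "len x \<le> x"
  by (simp add: len_le_iff)

lemma recursive_len [rec_intros]:
  assumes "recursive f" shows "recursive (\<lambda>x. len (f x))"
  unfolding len_eq_Least
proof (rule recursive_Least)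
  show "decidable (\<lambda>z. f (pfst z) < 2 ^ psnd z)" by (intro rec_intros assms[THEN recursive_comp])
  show "\<exists>k. f x < 2 ^ k" for x using less_exp by blast
qed

text \<open>Sum the weights of the arguments \<open>x < t\<close> seen to halt by stage
  \<open>t\<close>. Since \<open>len x \<le> x\<close>, these weights are multiples of
  \<open>1 / 2 ^ t\<close>, so natural numerators suffice.\<close>

lemma left_re_numbering_approx:
  assumes "left_re_numbering \<alpha>"
  obtains a :: "nat \<Rightarrow> nat \<Rightarrow> nat"
  where "\<And>f g. recursive f \<Longrightarrow> recursive g \<Longrightarrow> recursive (\<lambda>x. a (f x) (g x))"
    and "\<And>e t. real (a e t) / 2 ^ t \<le> \<alpha> e"
    and "\<And>e \<epsilon>. \<epsilon> > 0 \<Longrightarrow> \<exists>t0. \<forall>t\<ge>t0. \<alpha> e - \<epsilon> \<le> real (a e t) / 2 ^ t"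
proof -
  obtain \<phi> where \<phi>: "partial_recursive \<phi>"
    "\<And>e. ((\<lambda>x. 1 / 2 ^ len x) has_sum \<alpha> e) {x. \<phi> (pe e x) \<noteq> None}"
    using assms unfolding left_re_numbering_def by blast
  obtain \<Phi> where \<Phi>: "stages \<phi> \<Phi>" using partial_recursive_stages[OF \<phi>(1)] by blast
  define a where "a e t = (\<Sum>x<t. if \<Phi> (pe e x) t = 0 then 0 else (2::nat) ^ (t - len x))" for e t
  define D where "D e t = {x. x < t \<and> \<Phi> (pe e x) t \<noteq> 0}" for e t
  have a_eq: "real (a e t) / 2 ^ t = (\<Sum>x\<in>D e t. 1 / 2 ^ len x)" for e t
  proof -
    have "real (a e t) / 2 ^ t = (\<Sum>x<t. if \<Phi> (pe e x) t = 0 then 0 else 2 ^ (t - len x) / 2 ^ t)"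
      by (auto simp: a_def sum_divide_distrib intro!: sum.cong)
    also have "\<dots> = (\<Sum>x<t. if \<Phi> (pe e x) t \<noteq> 0 then 1 / 2 ^ len x else 0)"
    proof (rule sum.cong[OF refl])
      fix x assume "x \<in> {..<t}"
      then have "len x \<le> t" using len_le_self[of x] by simp
      then show "(if \<Phi> (pe e x) t = 0 then 0 else 2 ^ (t - len x) / 2 ^ t) =
          (if \<Phi> (pe e x) t \<noteq> 0 then 1 / 2 ^ len x else (0::real))"
        by (simp add: power_diff)
    qed
    also have "\<dots> = (\<Sum>x\<in>D e t. 1 / 2 ^ len x)"
      by (auto simp: D_def sum.inter_filter[symmetric] intro!: sum.cong)
    finally show ?thesis .
  qed
  have D_fin: "finite (D e t)" for e t by (simp add: D_def)
  have D_sub: "D e t \<subseteq> {x. \<phi> (pe e x) \<noteq> None}" for e t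
    using stages_sound[OF \<Phi>] by (auto simp: D_def)
  show thesis
  proof (rule that[of a])
    show "recursive (\<lambda>x. a (f x) (g x))" if "recursive f" "recursive g" for f g
      unfolding a_def by (intro rec_intros that[THEN recursive_comp] stages_recursive[OF \<Phi>] that)
  next
    show "real (a e t) / 2 ^ t \<le> \<alpha> e" for e t
      unfolding a_eq using \<phi>(2)[of e] D_fin D_sub by (rule finite_sum_le_has_sum) auto
  next
    fix e and \<epsilon> :: real assume "\<epsilon> > 0"
    then obtain F where F: "finite F" "F \<subseteq> {x. \<phi> (pe e x) \<noteq> None}"
      "dist (\<Sum>x\<in>F. 1 / 2 ^ len x) (\<alpha> e) \<le> \<epsilon>"
      using has_sum_finite_approximation[OF \<phi>(2)] by blast
    have "\<forall>x\<in>F. \<exists>s. \<forall>t\<ge>s. \<Phi> (pe e x) t \<noteq> 0"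
    proof
      fix x assume "x \<in> F"
      then obtain y where "\<phi> (pe e x) = Some y" using F(2) by auto
      then obtain s where "\<forall>t\<ge>s. \<Phi> (pe e x) t = Suc y" using stages_complete[OF \<Phi>] by blast
      then have "\<forall>t\<ge>s. \<Phi> (pe e x) t \<noteq> 0" by simp
      then show "\<exists>s. \<forall>t\<ge>s. \<Phi> (pe e x) t \<noteq> 0" by blast
    qed
    then obtain T where T: "\<And>x t. x \<in> F \<Longrightarrow> T x \<le> t \<Longrightarrow> \<Phi> (pe e x) t \<noteq> 0" by metis
    have "\<alpha> e - \<epsilon> \<le> real (a e t) / 2 ^ t" if t: "t \<ge> (\<Sum>x\<in>F. T x + Suc x)" for t
    proof -
      have "F \<subseteq> D e t"
      proof
        fix x assume x: "x \<in> F"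
        have "T x + Suc x \<le> t" using member_le_sum[OF x, of "\<lambda>x. T x + Suc x"] F(1) t by simp
        then show "x \<in> D e t" using T[OF x, of t] by (simp add: D_def)
      qed
      then have "(\<Sum>x\<in>F. 1 / 2 ^ len x) \<le> real (a e t) / 2 ^ t"
        unfolding a_eq by (intro sum_mono2 D_fin) auto
      then show ?thesis using F(3) by (simp add: dist_real_def abs_le_iff)
    qed
    then show "\<exists>t0. \<forall>t\<ge>t0. \<alpha> e - \<epsilon> \<le> real (a e t) / 2 ^ t" by blast
  qed
qed

section \<open>Coding sets of numbers by base 4 expansions\<close>

definition base4 :: "(nat \<Rightarrow> nat) \<Rightarrow> real" where
  "base4 G = (\<Sum>n. real (G n) / 4 ^ Suc n)"

lemma sums_base4_const: "(\<lambda>n. 1 / 4 ^ Suc n :: real) sums (1 / 3)"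
  using sums_mult[OF geometric_sums[of "1/4::real"], of "1/4"] by (simp add: power_divide)

lemma summable_base4: 
  assumes "\<And>n. G n \<le> 1"
  shows "summable (\<lambda>n. real (G n) / 4 ^ Suc n)"
proof (rule summable_comparison_test'[OF sums_summable[OF sums_base4_const], of 0])
  show "norm (real (G n) / 4 ^ Suc n) \<le> 1 / 4 ^ Suc n" for n
    using assms[of n] by (simp add: divide_right_mono)
qed

lemma base4_bounds:
  assumes "\<And>n. G n \<le> 1"
  shows "0 \<le> base4 G" "base4 G \<le> 1 / 3"
proof -
  show "0 \<le> base4 G" unfolding base4_def by (intro suminf_nonneg summable_base4 assms) simp
  have "base4 G \<le> (\<Sum>n. 1 / 4 ^ Suc n)" unfolding base4_def
    using assms by (intro suminf_le summable_base4[OF assms] sums_summable[OF sums_base4_const])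
      (simp add: divide_right_mono)
  then show "base4 G \<le> 1 / 3" using sums_unique[OF sums_base4_const] by simp
qed

text \<open>The complementary sequence supplies approximations of \<open>base4 G\<close> from above,
  so two left-r.e. numbers together determine a computable one.\<close>

lemma base4_complement:
  assumes "\<And>n. G n \<le> 1"
  shows "base4 G + base4 (\<lambda>n. 1 - G n) = 1 / 3"
proof -
  have "base4 G + base4 (\<lambda>n. 1 - G n) = (\<Sum>n. real (G n) / 4 ^ Suc n + real (1 - G n) / 4 ^ Suc n)"
    unfolding base4_def by (intro suminf_add summable_base4[OF assms] summable_base4) simp
  also have "\<dots> = (\<Sum>n. 1 / 4 ^ Suc n)"
    using assms by (intro suminf_cong) (simp add: add_divide_distrib[symmetric] of_nat_diff)
  finally show ?thesis using sums_unique[OF sums_base4_const] by simp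
qed

lemma left_re_base4:
  assumes G: "recursive G" and le: "\<And>n. G n \<le> 1"
  shows "left_re (base4 G)"
  unfolding left_re_def
proof (intro conjI exI)
  show "base4 G \<in> {0..1}" using base4_bounds[of G] le by simp
  let ?q = "\<lambda>N. \<Sum>n<N. rat_of_nat (G n) / 4 ^ Suc n"
  let ?a = "\<lambda>N. \<Sum>n<N. G n * 4 ^ (N - Suc n)"
  show "recursive_rat_seq ?q"
    unfolding recursive_rat_seq_def
  proof (intro exI conjI allI)
    show "recursive ?a" by (intro rec_intros G[THEN recursive_comp])
    show "recursive (\<lambda>_. 0)" "recursive (\<lambda>N. 4 ^ N - 1)" by (intro rec_intros)+
    fix N
    have "of_nat (?a N) = ?q N * 4 ^ N"
      unfolding of_nat_sum sum_distrib_right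
    proof (intro sum.cong refl)
      fix n assume "n \<in> {..<N}"
      then have "N = (N - Suc n) + Suc n" by simp
      then have "(4::rat) ^ N = 4 ^ (N - Suc n) * 4 ^ Suc n" by (metis power_add)
      then show "rat_of_nat (G n * 4 ^ (N - Suc n)) = rat_of_nat (G n) / 4 ^ Suc n * 4 ^ N" by simp
    qed
    moreover have "rat_of_nat (Suc (4 ^ N - 1)) = 4 ^ N" by simp
    ultimately show "?q N = (rat_of_nat (?a N) - of_nat 0) / of_nat (Suc (4 ^ N - 1))"
      by simp
  qed
  show "incseq ?q" by (intro incseq_SucI) simp
  have "(\<lambda>N. \<Sum>n<N. real (G n) / 4 ^ Suc n) \<longlonglongrightarrow> base4 G"
    unfolding base4_def by (rule summable_LIMSEQ[OF summable_base4[OF le]])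
  then show "(\<lambda>N. real_of_rat (?q N)) \<longlonglongrightarrow> base4 G"
    by (simp add: of_rat_sum of_rat_divide of_rat_mult of_rat_power)
qed

text \<open>The digits are \<open>0\<close> and \<open>1\<close>, so the tail is at most \<open>1 / 3\<close> and rounding recovers the head.\<close>

lemma base4_digit:
  fixes a t n :: nat
  assumes le: "\<And>n. G n \<le> 1"
    and up: "real a / 2 ^ t \<le> base4 G" and low: "base4 G - 1 / 4 ^ (n + 3) \<le> real a / 2 ^ t"
  shows "((2 * a * 4 ^ Suc n + 2 ^ t) div 2 ^ Suc t) mod 2 = G n"
proof -
  define K where "K = (\<Sum>i<Suc n. G i * 4 ^ (n - i))"
  define f where "f = base4 (\<lambda>i. G (i + Suc n))"
  have f: "0 \<le> f" "f \<le> 1 / 3" unfolding f_def by (intro base4_bounds le)+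
  have "base4 G = (\<Sum>i. real (G (i + Suc n)) / 4 ^ Suc (i + Suc n)) + (\<Sum>i<Suc n. real (G i) / 4 ^ Suc i)"
    unfolding base4_def by (rule suminf_split_initial_segment[OF summable_base4[OF le]])
  also have "(\<Sum>i. real (G (i + Suc n)) / 4 ^ Suc (i + Suc n)) = f / 4 ^ Suc n"
  proof -
    have "(\<lambda>i. real (G (i + Suc n)) / 4 ^ Suc (i + Suc n)) = (\<lambda>i. real (G (i + Suc n)) / 4 ^ Suc i / 4 ^ Suc n)"
      by (simp add: fun_eq_iff power_add)
    then show ?thesis
      unfolding f_def base4_def by (simp only: suminf_divide[OF summable_base4[OF le]])
  qed
  also have "(\<Sum>i<Suc n. real (G i) / 4 ^ Suc i) = real K / 4 ^ Suc n"
    unfolding K_def of_nat_sum sum_divide_distrib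
  proof (intro sum.cong refl)
    fix i assume "i \<in> {..<Suc n}"
    then have "Suc n = (n - i) + Suc i" by simp
    then have "(4::real) ^ Suc n = 4 ^ (n - i) * 4 ^ Suc i" by (metis power_add)
    then show "real (G i) / 4 ^ Suc i = real (G i * 4 ^ (n - i)) / 4 ^ Suc n" by simp
  qed
  finally have b4: "base4 G = (real K + f) / 4 ^ Suc n" by (simp add: add_divide_distrib)
  define \<rho> where "\<rho> = 4 ^ Suc n * (real a / 2 ^ t)"
  have "\<rho> \<le> real K + f" "real K + f - 1 / 16 \<le> \<rho>"
  proof -
    have p: "(4::real) ^ Suc n > 0" by simp
    show "\<rho> \<le> real K + f" using mult_left_mono[OF up, of "4 ^ Suc n"] by (simp add: \<rho>_def b4)
    have "4 ^ Suc n * (base4 G - 1 / 4 ^ (n + 3)) = real K + f - 1 / 16"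
      unfolding b4 by (simp add: field_simps power_add)
    then show "real K + f - 1 / 16 \<le> \<rho>" using mult_left_mono[OF low, of "4 ^ Suc n"] by (simp add: \<rho>_def)
  qed
  \<comment> \<open>The tail \<open>f\<close> is at most 1/3 and the error at most 1/16, so adding
    1/2 lands between \<open>K\<close> and \<open>K + 1\<close>.\<close>
  then have \<rho>: "real K \<le> \<rho> + 1 / 2" "\<rho> + 1 / 2 < real K + 1" using f by linarith+
  have eq: "real (2 * a * 4 ^ Suc n + 2 ^ t) = 2 ^ Suc t * (\<rho> + 1 / 2)"
    unfolding \<rho>_def by (simp add: field_simps)
  have "real (2 ^ Suc t * K) \<le> real (2 * a * 4 ^ Suc n + 2 ^ t)"
    unfolding eq using mult_left_mono[OF \<rho>(1), of "2 ^ Suc t"] by simp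
  moreover have "real (2 * a * 4 ^ Suc n + 2 ^ t) < real (2 ^ Suc t * Suc K)"
    unfolding eq using mult_strict_left_mono[OF \<rho>(2), of "2 ^ Suc t"] by (simp add: algebra_simps)
  ultimately have "(2 * a * 4 ^ Suc n + 2 ^ t) div 2 ^ Suc t = K"
    by (intro div_nat_eqI) (simp_all only: of_nat_le_iff of_nat_less_iff)
  moreover have "K mod 2 = G n"
  proof -
    have "even (\<Sum>i<n. G i * 4 ^ (n - i))" by (intro dvd_sum) (auto simp: even_power)
    moreover have "K = (\<Sum>i<n. G i * 4 ^ (n - i)) + G n" by (simp add: K_def)
    ultimately show ?thesis using le[of n] by (auto elim!: evenE simp: mod_Suc)
  qed
  ultimately show ?thesis by simp
qed

text \<open>
  An index \<open>c\<close> codes \<open>i\<close> and \<open>j\<close>. If \<open>\<alpha> i + \<alpha> j = 1 / 3\<close> then \<open>\<alpha> i\<close> is computable, and the graph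
  of a function is read off its base \<open>4\<close> digits: \<open>chk c x s\<close> says that \<open>psnd s\<close> stages suffice to see
  that the pair of \<open>x\<close> and \<open>pfst s\<close> is in the graph.
\<close>

lemma universal_enumeration:
  assumes "left_re_numbering \<alpha>" "universal_numbering \<alpha>"
  obtains chk :: "nat \<Rightarrow> nat \<Rightarrow> nat \<Rightarrow> bool"
  where "\<And>f g h. recursive f \<Longrightarrow> recursive g \<Longrightarrow> recursive h \<Longrightarrow> decidable (\<lambda>x. chk (f x) (g x) (h x))"
    and "\<And>d. recursive d \<Longrightarrow> \<exists>c. \<forall>x. (\<exists>s. chk c x s) \<and> (\<forall>s. chk c x s \<longrightarrow> pfst s = d x)"
proof -
  obtain a where a: "\<And>f g. recursive f \<Longrightarrow> recursive g \<Longrightarrow> recursive (\<lambda>x. a (f x) (g x))"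
    "\<And>e t. real (a e t) / 2 ^ t \<le> \<alpha> e"
    "\<And>e \<epsilon>. \<epsilon> > 0 \<Longrightarrow> \<exists>t0. \<forall>t\<ge>t0. \<alpha> e - \<epsilon> \<le> real (a e t) / 2 ^ t"
    by (rule left_re_numbering_approx[OF assms(1)]) blast
  \<comment> \<open>The first conjunct says that the approximations add up to 1/3 within
    \<open>1 / 4 ^ (n + 3)\<close>, for \<open>n = pe x (pfst s)\<close>, cleared of denominators;
    the second reads digit \<open>n\<close> as in \<open>base4_digit\<close>.\<close>
  define chk where "chk c x s \<longleftrightarrow>
     4 ^ (pe x (pfst s) + 3) * 2 ^ psnd s \<le>
       3 * (a (pfst c) (psnd s) + a (psnd c) (psnd s)) * 4 ^ (pe x (pfst s) + 3) + 3 * 2 ^ psnd s \<and>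
     ((2 * a (pfst c) (psnd s) * 4 ^ Suc (pe x (pfst s)) + 2 ^ psnd s) div 2 ^ Suc (psnd s)) mod 2 = 1"
    for c x s
  show thesis
  proof (rule that[of chk])
    show "decidable (\<lambda>x. chk (f x) (g x) (h x))" if "recursive f" "recursive g" "recursive h" for f g h
      unfolding chk_def by (intro rec_intros a(1) that)
  next
    fix d assume d: "recursive d"
    define G where "G n = (of_bool (d (pfst n) = psnd n) :: nat)" for n
    have G1: "G n \<le> 1" for n by (simp add: G_def)
    have G1': "1 - G n \<le> 1" for n by simp
    have "recursive G" unfolding G_def by (intro rec_intros d[THEN recursive_comp])
    then have "recursive (\<lambda>n. 1 - G n)" by (intro rec_intros)
    then obtain i j where ij: "\<alpha> i = base4 G" "\<alpha> j = base4 (\<lambda>n. 1 - G n)"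
      using left_re_base4[of G] left_re_base4[of "\<lambda>n. 1 - G n"] assms(2) G1 G1' \<open>recursive G\<close>
      unfolding universal_numbering_def by metis
    have sum: "\<alpha> i + \<alpha> j = 1 / 3" unfolding ij by (rule base4_complement[OF G1])
    have cond: "4 ^ (n + 3) * 2 ^ t \<le> 3 * (a i t + a j t) * 4 ^ (n + 3) + 3 * 2 ^ t \<longleftrightarrow>
        1 / 3 - 1 / 4 ^ (n + 3) \<le> real (a i t) / 2 ^ t + real (a j t) / 2 ^ t" for n t
    proof -
      have "4 ^ (n + 3) * 2 ^ t \<le> 3 * (a i t + a j t) * 4 ^ (n + 3) + 3 * 2 ^ t \<longleftrightarrow>
        real (4 ^ (n + 3) * 2 ^ t) \<le> real (3 * (a i t + a j t) * 4 ^ (n + 3) + 3 * 2 ^ t)"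
        by (simp only: of_nat_le_iff)
      also have "\<dots> \<longleftrightarrow> 1 / 3 - 1 / 4 ^ (n + 3) \<le> real (a i t) / 2 ^ t + real (a j t) / 2 ^ t"
        by (simp add: field_simps)
      finally show ?thesis .
    qed
    have digit: "((2 * a i t * 4 ^ Suc n + 2 ^ t) div 2 ^ Suc t) mod 2 = G n"
      if "1 / 3 - 1 / 4 ^ (n + 3) \<le> real (a i t) / 2 ^ t + real (a j t) / 2 ^ t" for n t
    proof (rule base4_digit[OF G1])
      show "real (a i t) / 2 ^ t \<le> base4 G" using a(2)[of i t] ij by simp
      \<comment> \<open>The approximation to \<open>\<alpha> j\<close> lies below it, so if both
        approximations nearly add up to 1/3, the one to \<open>\<alpha> i\<close> is itself nearly
        exact.\<close>
      show "base4 G - 1 / 4 ^ (n + 3) \<le> real (a i t) / 2 ^ t" using that a(2)[of j t] ij(1) sum by simp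
    qed
    have "\<forall>x. (\<exists>s. chk (pe i j) x s) \<and> (\<forall>s. chk (pe i j) x s \<longrightarrow> pfst s = d x)"
    proof (intro allI conjI impI)
      fix x
      let ?n = "pe x (d x)"
      have e: "(1 / 4 ^ (?n + 3)) / 2 > (0::real)" by simp
      obtain t1 t2 where "\<forall>t\<ge>t1. \<alpha> i - (1 / 4 ^ (?n + 3)) / 2 \<le> real (a i t) / 2 ^ t"
          "\<forall>t\<ge>t2. \<alpha> j - (1 / 4 ^ (?n + 3)) / 2 \<le> real (a j t) / 2 ^ t"
        using a(3)[OF e, of i] a(3)[OF e, of j] by blast
      then have "\<alpha> i - (1 / 4 ^ (?n + 3)) / 2 \<le> real (a i (max t1 t2)) / 2 ^ (max t1 t2)"
        "\<alpha> j - (1 / 4 ^ (?n + 3)) / 2 \<le> real (a j (max t1 t2)) / 2 ^ (max t1 t2)"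
        by (meson max.cobounded1 max.cobounded2)+
      then have *: "1 / 3 - 1 / 4 ^ (?n + 3) \<le> real (a i (max t1 t2)) / 2 ^ (max t1 t2) + real (a j (max t1 t2)) / 2 ^ (max t1 t2)"
        using sum by linarith
      have "G ?n = 1" by (simp add: G_def)
      then have "chk (pe i j) x (pe (d x) (max t1 t2))"
        unfolding chk_def fst_conv snd_conv prod_encode_inverse cond using * digit[OF *] by simp
      then show "\<exists>s. chk (pe i j) x s" by blast
    next
      fix x s assume "chk (pe i j) x s"
      then have c: "1 / 3 - 1 / 4 ^ (pe x (pfst s) + 3) \<le> real (a i (psnd s)) / 2 ^ psnd s + real (a j (psnd s)) / 2 ^ psnd s"
        and b: "((2 * a i (psnd s) * 4 ^ Suc (pe x (pfst s)) + 2 ^ psnd s) div 2 ^ Suc (psnd s)) mod 2 = 1"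
        unfolding chk_def fst_conv snd_conv prod_encode_inverse cond by blast+
      have "G (pe x (pfst s)) = 1" using digit[OF c] b by simp
      then show "pfst s = d x" by (cases "d x = pfst s") (auto simp: G_def)
    qed
    then show "\<exists>c. \<forall>x. (\<exists>s. chk c x s) \<and> (\<forall>s. chk c x s \<longrightarrow> pfst s = d x)" by blast
  qed
qed

section \<open>Dominating functions\<close>

lemma eventually_all_less_nat:
  fixes n :: nat
  assumes "\<And>i. i < n \<Longrightarrow> eventually (P i) F"
  shows "eventually (\<lambda>x. \<forall>i<n. P i x) F"
  using eventually_ball_finite[of "{..<n}" "\<lambda>x i. P i x" F] assms by (simp add: Ball_def)

lemma eventually_all_le_nat:
  fixes n :: nat
  assumes "\<And>i. i \<le> n \<Longrightarrow> eventually (P i) F"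
  shows "eventually (\<lambda>x. \<forall>i\<le>n. P i x) F"
  using eventually_all_less_nat[of "Suc n" P F] assms by (simp add: less_Suc_eq_le)

lemma eventually_sequentially_upward:
  fixes P :: "nat \<Rightarrow> bool"
  assumes "\<And>s t. P s \<Longrightarrow> s \<le> t \<Longrightarrow> P t" "\<exists>s. P s"
  shows "eventually P sequentially"
  using assms unfolding eventually_sequentially by blast

text \<open>
  Here \<open>c j x s\<close> says that at stage \<open>s\<close> the \<open>j\<close>-th partial function has been seen to converge
  below \<open>x\<close>. It may act on \<open>m\<close> only if each \<open>i < j\<close> has either converged beyond \<open>m\<close> or not
  progressed since stage \<open>m\<close>.
\<close>

definition acts :: "(nat \<Rightarrow> nat \<Rightarrow> nat \<Rightarrow> bool) \<Rightarrow> nat \<Rightarrow> nat \<Rightarrow> nat \<Rightarrow> bool" where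
  "acts c j m s \<longleftrightarrow> c j m s \<and> (\<forall>i<j. c i m s \<or> (\<forall>x<s. c i x s \<longrightarrow> c i x m))"

locale progress =
  fixes c :: "nat \<Rightarrow> nat \<Rightarrow> nat \<Rightarrow> bool"
  assumes mono: "c j x s \<Longrightarrow> s \<le> t \<Longrightarrow> c j x t"
    and down: "c j x s \<Longrightarrow> y \<le> x \<Longrightarrow> c j y s"
    and bound: "c j x s \<Longrightarrow> x + 1 < s"
    and start: "c j x s \<Longrightarrow> j + 2 \<le> s"
    and zero: "\<exists>s. c j 0 s"
begin

definition total :: "nat set" where "total = {j. \<forall>x. \<exists>s. c j x s}"

text \<open>Convergence is closed downwards, so a non-total index converges only below some
  \<open>b\<close>, and finitely many arguments have a common last stage.\<close>

lemma settles:
  assumes "j \<notin> total"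
  shows "\<exists>s. \<forall>x t. c j x t \<longrightarrow> c j x s"
proof -
  obtain b where b: "\<And>s. \<not> c j b s" using assms by (auto simp: total_def)
  have "eventually (\<lambda>s. (\<exists>t. c j x t) \<longrightarrow> c j x s) sequentially" for x
    by (cases "\<exists>t. c j x t") (auto intro!: eventually_sequentially_upward intro: mono)
  then have "eventually (\<lambda>s. \<forall>x<b. (\<exists>t. c j x t) \<longrightarrow> c j x s) sequentially"
    by (intro eventually_all_less_nat)
  then obtain s where s: "\<forall>x<b. (\<exists>t. c j x t) \<longrightarrow> c j x s"
    unfolding eventually_sequentially by blast
  have "c j x s" if "c j x t" for x t
    using s b[of t] down[OF that, of b] that by (meson not_less)
  then show ?thesis by blast
qed

text \<open>For large \<open>m\<close> the smaller non-total indices have stopped progressing by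
  stage \<open>m\<close>; the smaller total ones converge at \<open>m\<close> at a late enough
  stage, together with \<open>j\<close>.\<close>

lemma acts_total:
  assumes "j \<in> total"
  shows "\<exists>m0. \<forall>m\<ge>m0. \<exists>s. acts c j m s"
proof -
  have "eventually (\<lambda>m. i \<notin> total \<longrightarrow> (\<forall>x t. c i x t \<longrightarrow> c i x m)) sequentially" for i
    using settles[of i] by (cases "i \<in> total") (auto intro!: eventually_sequentially_upward intro: mono)
  then have "eventually (\<lambda>m. \<forall>i<j. i \<notin> total \<longrightarrow> (\<forall>x t. c i x t \<longrightarrow> c i x m)) sequentially"
    by (intro eventually_all_less_nat)
  then obtain m0 where m0: "\<And>m i x t. m \<ge> m0 \<Longrightarrow> i < j \<Longrightarrow> i \<notin> total \<Longrightarrow> c i x t \<Longrightarrow> c i x m"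
    unfolding eventually_sequentially by blast
  have "\<exists>s. acts c j m s" if m: "m \<ge> m0" for m
  proof -
    have "eventually (\<lambda>s. i \<in> total \<longrightarrow> c i m s) sequentially" for i
      by (cases "i \<in> total") (auto simp: total_def intro!: eventually_sequentially_upward intro: mono)
    then have "eventually (\<lambda>s. \<forall>i\<le>j. i \<in> total \<longrightarrow> c i m s) sequentially"
      by (intro eventually_all_le_nat)
    then obtain s where "\<forall>i\<le>j. i \<in> total \<longrightarrow> c i m s" unfolding eventually_sequentially by blast
    then have "acts c j m s" unfolding acts_def using m0[OF m] assms by (meson le_refl less_imp_le)
    then show ?thesis by blast
  qed
  then show ?thesis by blast
qed

text \<open>
  Take \<open>j\<close> non-total whose last progress, at stage \<open>st j\<close>, is no earlier than that of all
  non-total \<open>i < j\<close>. Then no non-total index ever acts on \<open>m = st j - 1\<close>: those below \<open>j\<close>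
  and \<open>j\<close> itself never get beyond \<open>m\<close>, and those above \<open>j\<close> are blocked by the progress of \<open>j\<close>.
\<close>

lemma acts_only_total:
  assumes inf: "infinite (- total)"
  shows "\<exists>m\<ge>b. \<forall>j s. acts c j m s \<longrightarrow> j \<in> total"
proof -
  define st where "st j = (LEAST s. \<forall>x t. c j x t \<longrightarrow> c j x s)" for j
  have st: "c j x (st j)" if "j \<notin> total" "c j x t" for j x t
    using LeastI_ex[OF settles[OF that(1)]] that(2) unfolding st_def by blast
  \<comment> \<open>By \<open>start\<close> a large index cannot progress early, so
    \<open>j1 \<ge> b\<close> forces the chosen stage, and with it \<open>m\<close>, to be at least
    \<open>b\<close>.\<close>
  obtain j1 where j1: "j1 \<ge> b" "j1 \<notin> total"
    using inf unfolding infinite_nat_iff_unbounded_le by auto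
  let ?N = "{j. j \<le> j1 \<and> j \<notin> total}"
  have N: "finite ?N" "?N \<noteq> {}" using j1 by auto
  obtain j0 where j0: "j0 \<in> ?N" "st j0 = Max (st ` ?N)"
    using Max_in[of "st ` ?N"] N by (metis (no_types, lifting) finite_imageI image_iff image_is_empty)
  have max: "st j \<le> st j0" if "j \<in> ?N" for j using N that by (simp add: j0(2))
  have j0': "j0 \<notin> total" "j0 \<le> j1" using j0 by auto
  have "st j1 \<ge> j1 + 2"
  proof -
    obtain s where "c j1 0 s" using zero by blast
    then show ?thesis using st[OF j1(2)] start by blast
  qed
  then have big: "st j0 \<ge> b + 2" using max[of j1] j1 by simp
  define m where "m = st j0 - 1"
  have m: "st j0 = Suc m" "m \<ge> b" using big by (auto simp: m_def)
  have "\<not> (\<forall>x t. c j0 x t \<longrightarrow> c j0 x m)"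
    unfolding st_def using not_less_Least[of m "\<lambda>s. \<forall>x t. c j0 x t \<longrightarrow> c j0 x s"] m(1)
    by (simp add: st_def)
  then obtain x t where xt: "c j0 x t" "\<not> c j0 x m" by blast
  have x: "c j0 x (Suc m)" using st[OF j0'(1) xt(1)] m(1) by simp
  have no: "\<not> c j m s" if "j \<notin> total" "j \<le> j0" for j s
  proof
    assume "c j m s"
    then have "c j m (st j)" using st that by blast
    then have "m + 1 < st j" by (rule bound)
    moreover have "st j \<le> Suc m" using max[of j] that j0' m(1) by simp
    ultimately show False by simp
  qed
  have "j \<in> total" if a: "acts c j m s" for j s
  proof (rule ccontr)
    assume j: "j \<notin> total"
    have cs: "c j m s" using a by (simp add: acts_def)
    then have "j0 < j" using no[OF j] by (meson not_less)
    moreover have "m + 1 < s" using cs by (rule bound)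
    moreover have "\<not> c j0 m s" using no[OF j0'(1)] by simp
    moreover have "c j0 x s" using mono[OF x] \<open>m + 1 < s\<close> by simp
    moreover have "x < s" using bound[OF \<open>c j0 x s\<close>] by simp
    ultimately show False using a xt(2) by (auto simp: acts_def)
  qed
  then show ?thesis using m(2) by blast
qed

end

text \<open>Lists are right-nested pairs without end marker: every number has entries at all
  positions, so no length is stored.\<close>

definition entry :: "nat \<Rightarrow> nat \<Rightarrow> nat" where
  "entry k i = pfst (rec_nat k (\<lambda>_ r. psnd r) i)"

lemma recursive_entry [rec_intros]:
  assumes "recursive f" "recursive g" shows "recursive (\<lambda>x. entry (f x) (g x))"
  unfolding entry_def by (intro rec_intros assms)

lemma entry_surj: "\<exists>k. \<forall>i\<le>n. entry k i = f i"
proof (induction n arbitrary: f)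
  case 0
  show ?case by (rule exI[of _ "pe (f 0) 0"]) (simp add: entry_def)
next
  case (Suc n)
  obtain k where k: "\<forall>i\<le>n. entry k i = f (Suc i)" using Suc[of "\<lambda>i. f (Suc i)"] by blast
  have shift: "rec_nat (pe a k) (\<lambda>_ r. psnd r) (Suc i) = rec_nat k (\<lambda>_ r. psnd r) i" for a i
    by (induction i) simp_all
  have "entry (pe (f 0) k) i = f i" if "i \<le> Suc n" for i
  proof (cases i)
    case 0 then show ?thesis by (simp add: entry_def)
  next
    case (Suc i')
    then have "entry (pe (f 0) k) i = entry k i'" unfolding entry_def using shift by metis
    then show ?thesis using k Suc that by simp
  qed
  then show ?case by blast
qed

lemma Pi_set_4_cases:
  assumes "Pi_set 4 A"
  obtains R where "\<And>f. recursive f \<Longrightarrow> decidable (\<lambda>x. f x \<in> R)"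
    and "\<And>e. e \<in> A \<longleftrightarrow> (\<forall>n. \<exists>k. \<forall>x. \<exists>y. pe (pe (pe (pe e n) k) x) y \<in> R)"
proof -
  have "Pi_set (Suc (Suc (Suc (Suc 0)))) A" using assms by (simp only: eval_nat_numeral BitM.simps)
  then obtain B C D R where "A = {x. \<forall>y. pe x y \<in> B}" "B = {x. \<exists>y. pe x y \<in> C}"
      "C = {x. \<forall>y. pe x y \<in> D}" "D = {x. \<exists>y. pe x y \<in> R}" "recursive_set R"
    unfolding Sigma_set.simps Pi_set.simps by blast
  moreover from this have "decidable (\<lambda>x. f x \<in> R)" if "recursive f" for f
    using decidable_comp[of "\<lambda>x. x \<in> R" f] that by (simp add: recursive_set_def decidable_def)
  ultimately show thesis using that[of R] by simp
qed

text \<open>The interface to the universal numbering: \<open>chk\<close> verifies a computation with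
  output \<open>pfst s\<close>, and every recursive function has an index whose verified outputs are
  all correct.\<close>

locale enumeration =
  fixes chk :: "nat \<Rightarrow> nat \<Rightarrow> nat \<Rightarrow> bool"
  assumes decidable_chk:
      "recursive f \<Longrightarrow> recursive g \<Longrightarrow> recursive h \<Longrightarrow> decidable (\<lambda>x. chk (f x) (g x) (h x))"
    and chk_index: "recursive d \<Longrightarrow> \<exists>c. \<forall>x. (\<exists>s. chk c x s) \<and> (\<forall>s. chk c x s \<longrightarrow> pfst s = d x)"
begin

definition conv :: "nat \<Rightarrow> nat \<Rightarrow> nat \<Rightarrow> bool" where
  "conv c x t \<longleftrightarrow> (\<exists>s\<le>t. chk c x s)"

text \<open>The bound \<open>t\<close> makes the search recursive even at divergent arguments, and
  the default 0 keeps the value nondecreasing in \<open>t\<close>.\<close>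

definition val :: "nat \<Rightarrow> nat \<Rightarrow> nat \<Rightarrow> nat" where
  "val c x t = (if conv c x t then pfst (LEAST s. chk c x s \<or> t \<le> s) else 0)"

lemma decidable_conv [rec_intros]:
  assumes "recursive f" "recursive g" "recursive h"
  shows "decidable (\<lambda>x. conv (f x) (g x) (h x))"
  unfolding conv_def by (intro rec_intros decidable_chk assms assms[THEN recursive_comp])

lemma recursive_val [rec_intros]:
  assumes "recursive f" "recursive g" "recursive h"
  shows "recursive (\<lambda>x. val (f x) (g x) (h x))"
  unfolding val_def by (intro rec_intros decidable_chk assms assms[THEN recursive_comp])

lemma conv_mono: "conv c x s \<Longrightarrow> s \<le> t \<Longrightarrow> conv c x t"
  unfolding conv_def by (meson le_trans)

lemma val_conv:
  assumes "conv c x t"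
  shows "val c x t = pfst (LEAST s. chk c x s)"
proof -
  obtain s where s: "s \<le> t" "chk c x s" using assms by (auto simp: conv_def)
  have le: "(LEAST s. chk c x s) \<le> t" using Least_le[of "chk c x", OF s(2)] s(1) by simp
  have "(LEAST s. chk c x s \<or> t \<le> s) = (LEAST s. chk c x s)"
  proof (rule Least_equality)
    show "chk c x (LEAST s. chk c x s) \<or> t \<le> (LEAST s. chk c x s)" using LeastI[of "chk c x", OF s(2)] by simp
  qed (use le Least_le[of "chk c x"] in force)
  then show ?thesis using assms by (simp add: val_def)
qed

lemma val_stable: "conv c x s \<Longrightarrow> conv c x t \<Longrightarrow> val c x s = val c x t"
  by (simp add: val_conv)

lemma val_mono: "s \<le> t \<Longrightarrow> val c x s \<le> val c x t"
  by (cases "conv c x s") (use val_stable conv_mono in \<open>auto simp: val_def[of c x s]\<close>)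

lemma index:
  assumes "recursive d"
  obtains c where "\<And>x. \<exists>t. conv c x t" "\<And>x t. conv c x t \<Longrightarrow> val c x t = d x"
proof -
  obtain c where c: "\<And>x. \<exists>s. chk c x s" "\<And>x s. chk c x s \<Longrightarrow> pfst s = d x"
    using chk_index[OF assms] by blast
  show thesis
  proof (rule that[of c])
    show "\<exists>t. conv c x t" for x using c(1)[of x] by (auto simp: conv_def)
    show "val c x t = d x" if "conv c x t" for x t
      using val_conv[OF that] c(2)[OF LeastI_ex[OF c(1)]] by simp
  qed
qed

definition ctime :: "nat \<Rightarrow> nat \<Rightarrow> nat" where "ctime c x = (LEAST t. conv c x t)"

lemma recursive_ctime:
  assumes "\<And>x. \<exists>t. conv c x t"
  shows "recursive (ctime c)"
  unfolding ctime_def by (intro recursive_Least rec_intros assms)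

lemma conv_ctime: "\<exists>t. conv c x t \<Longrightarrow> conv c x (ctime c x)"
  unfolding ctime_def by (rule LeastI_ex)

text \<open>On a divergent argument \<open>val\<close> is constantly 0, so the unspecified value of
  \<open>ctime\<close> does no harm.\<close>

lemma val_le_limit: "val c x t \<le> val c x (ctime c x)"
proof (cases "conv c x t")
  case True
  then have "conv c x (ctime c x)" using conv_ctime by blast
  then show ?thesis using val_stable[OF True] by simp
qed (simp add: val_def[of c x t])

text \<open>If \<open>e \<in> A\<close>, any recursive \<open>d\<close> has a total index with
  correct witnesses, and it acts on almost all \<open>m\<close>. Otherwise
  \<open>acts_only_total\<close> gives infinitely many \<open>m\<close> on which only indices of
  finitely many total functions act, and these bound \<open>g\<close>.\<close>

lemma dominating_approximation:
  assumes "Pi_set 4 A"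
  obtains g :: "nat \<Rightarrow> nat \<Rightarrow> nat \<Rightarrow> nat"
  where "\<And>a b c. recursive a \<Longrightarrow> recursive b \<Longrightarrow> recursive c \<Longrightarrow> recursive (\<lambda>x. g (a x) (b x) (c x))"
    and "\<And>e m s t. s \<le> t \<Longrightarrow> g e m s \<le> g e m t"
    and "\<And>e m. \<exists>B. \<forall>s. g e m s \<le> B"
    and "\<And>e d. e \<in> A \<Longrightarrow> recursive d \<Longrightarrow> \<exists>m0. \<forall>m\<ge>m0. \<exists>s. d m \<le> g e m s"
    and "\<And>e. e \<notin> A \<Longrightarrow> \<exists>p. recursive p \<and> (\<forall>b. \<exists>m\<ge>b. \<forall>s. g e m s \<le> p m)"
proof -
  obtain R where R: "\<And>f. recursive f \<Longrightarrow> decidable (\<lambda>x. f x \<in> R)"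
    "\<And>e. e \<in> A \<longleftrightarrow> (\<forall>n. \<exists>k. \<forall>x. \<exists>y. pe (pe (pe (pe e n) k) x) y \<in> R)"
    using Pi_set_4_cases[OF assms] by blast
  \<comment> \<open>An index \<open>j\<close> codes a function \<open>pfst j\<close> and witnesses for the inner existential quantifier up to
    \<open>n = pfst j\<close>. If these fail at some \<open>n0\<close>, only the finitely many functions below \<open>n0\<close> survive.\<close>
  define Q where "Q e j x s \<longleftrightarrow> conv (pfst j) x s \<and>
      (\<forall>i\<le>pfst j. \<exists>y\<le>s. pe (pe (pe (pe e i) (entry (psnd j) i)) x) y \<in> R)" for e j x s
  define c where "c e j x s \<longleftrightarrow> x + 1 < s \<and> j + 2 \<le> s \<and> (\<forall>y<x. Q e j y s)" for e j x s
  have Q_mono: "Q e j x t" if "Q e j x s" "s \<le> t" for e j x s t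
    using that unfolding Q_def by (meson conv_mono le_trans)
  have c_mono: "c e j x t" if "c e j x s" "s \<le> t" for e j x s t
    using that Q_mono unfolding c_def by (meson le_trans less_le_trans)
  interpret P: progress "c e" for e
  proof
    fix j x s t
    show "c e j x s \<Longrightarrow> s \<le> t \<Longrightarrow> c e j x t" by (rule c_mono)
    show "c e j x s \<Longrightarrow> y \<le> x \<Longrightarrow> c e j y s" for y unfolding c_def by auto
    show "c e j x s \<Longrightarrow> x + 1 < s" "c e j x s \<Longrightarrow> j + 2 \<le> s" unfolding c_def by auto
    show "\<exists>s. c e j 0 s" by (rule exI[of _ "j + 2"]) (simp add: c_def)
  qed
  have total_iff: "j \<in> P.total e \<longleftrightarrow> (\<forall>x. \<exists>s. Q e j x s)" for e j
  proof
    assume j: "j \<in> P.total e"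
    show "\<forall>x. \<exists>s. Q e j x s"
    proof
      fix x
      obtain s where "c e j (Suc x) s" using j by (auto simp: P.total_def)
      then show "\<exists>s. Q e j x s" by (auto simp: c_def)
    qed
  next
    assume Q: "\<forall>x. \<exists>s. Q e j x s"
    have "\<exists>s. c e j x s" for x
    proof -
      have "eventually (\<lambda>s. \<forall>y<x. Q e j y s) sequentially"
        using Q Q_mono by (intro eventually_all_less_nat eventually_sequentially_upward) blast+
      moreover have "eventually (\<lambda>s. x + 1 < s) sequentially" by (rule eventually_gt_at_top)
      moreover have "eventually (\<lambda>s. j + 2 \<le> s) sequentially" by (rule eventually_ge_at_top)
      ultimately have "eventually (\<lambda>s. c e j x s) sequentially"
        unfolding c_def by eventually_elim blast
      then show ?thesis unfolding eventually_sequentially by blast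
    qed
    then show "j \<in> P.total e" by (simp add: P.total_def)
  qed
  \<comment> \<open>Acting on \<open>m\<close> certifies convergence only at arguments below
    \<open>m\<close>, hence the value at \<open>m - 1\<close>; for domination \<open>d\<close> is
    shifted by one accordingly.\<close>
  define g where "g e m s = (\<Sum>j\<le>m. if \<exists>t\<le>s. acts (c e) j m t then val (pfst j) (m - 1) s else 0)" for e m s
  show thesis
  proof (rule that[of g])
    fix a b d assume r: "recursive a" "recursive b" "recursive d"
    show "recursive (\<lambda>x. g (a x) (b x) (d x))"
      unfolding g_def acts_def c_def Q_def by (intro rec_intros R(1) r r[THEN recursive_comp])
  next
    fix e m s t :: nat assume st: "s \<le> t"
    show "g e m s \<le> g e m t" unfolding g_def
    proof (intro sum_mono)
      fix j
      show "(if \<exists>r\<le>s. acts (c e) j m r then val (pfst j) (m - 1) s else 0)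
        \<le> (if \<exists>r\<le>t. acts (c e) j m r then val (pfst j) (m - 1) t else 0)"
        using val_mono[OF st, of "pfst j" "m - 1"] st by (auto intro: le_trans)
    qed
  next
    fix e m
    have "g e m s \<le> (\<Sum>j\<le>m. val (pfst j) (m - 1) (ctime (pfst j) (m - 1)))" for s
      unfolding g_def by (intro sum_mono) (auto intro: val_le_limit)
    then show "\<exists>B. \<forall>s. g e m s \<le> B" by blast
  next
    fix e d assume e: "e \<in> A" and d: "recursive d"
    have "recursive (\<lambda>x. d (Suc x))" by (intro rec_intros d[THEN recursive_comp])
    then obtain i where i: "\<And>x. \<exists>t. conv i x t" "\<And>x t. conv i x t \<Longrightarrow> val i x t = d (Suc x)"
      using index by metis
    obtain f where f: "\<And>n x. \<exists>y. pe (pe (pe (pe e n) (f n)) x) y \<in> R" using e R(2) by metis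
    obtain k where k: "\<forall>n\<le>i. entry k n = f n" using entry_surj by blast
    have "pe i k \<in> P.total e" unfolding total_iff
    proof
      fix x
      have "eventually (\<lambda>s. conv i x s) sequentially"
        using i(1) conv_mono by (intro eventually_sequentially_upward) blast+
      moreover have "eventually (\<lambda>s. \<forall>n\<le>i. \<exists>y\<le>s. pe (pe (pe (pe e n) (entry k n)) x) y \<in> R) sequentially"
      proof (intro eventually_all_le_nat eventually_sequentially_upward)
        fix n assume "n \<le> i"
        then show "\<exists>s. \<exists>y\<le>s. pe (pe (pe (pe e n) (entry k n)) x) y \<in> R" using f[of n x] k by auto
      qed (meson le_trans)
      ultimately have "eventually (\<lambda>s. Q e (pe i k) x s) sequentially"
        unfolding Q_def by eventually_elim simp
      then show "\<exists>s. Q e (pe i k) x s" unfolding eventually_sequentially by blast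
    qed
    from P.acts_total[OF this] obtain m0 where m0: "\<And>m. m \<ge> m0 \<Longrightarrow> \<exists>s. acts (c e) (pe i k) m s" by blast
    have "\<exists>s. d m \<le> g e m s" if m: "m \<ge> m0 + Suc (pe i k)" for m
    proof -
      obtain s where s: "acts (c e) (pe i k) m s" using m0[of m] m by auto
      then have "\<forall>y<m. Q e (pe i k) y s" by (simp add: acts_def c_def)
      then have "conv i (m - 1) s" using m by (simp add: Q_def)
      then have "d m = val i (m - 1) s" using i(2) m by simp
      also have "\<dots> = (if \<exists>t\<le>s. acts (c e) (pe i k) m t then val (pfst (pe i k)) (m - 1) s else 0)"
        using s by auto
      also have "\<dots> \<le> g e m s" unfolding g_def using m
        by (intro member_le_sum[of "pe i k" "{..m}"
          "\<lambda>j. if \<exists>t\<le>s. acts (c e) j m t then val (pfst j) (m - 1) s else 0"]) auto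
      finally show ?thesis by blast
    qed
    then show "\<exists>m0. \<forall>m\<ge>m0. \<exists>s. d m \<le> g e m s" by blast
  next
    fix e assume "e \<notin> A"
    then obtain n0 where n0: "\<And>k. \<exists>x. \<forall>y. pe (pe (pe (pe e n0) k) x) y \<notin> R" using R(2) by metis
    have total_less: "pfst j < n0" if "j \<in> P.total e" for j
    proof (rule ccontr)
      assume "\<not> pfst j < n0"
      then have "n0 \<le> pfst j" by simp
      then have "\<forall>x. \<exists>y. pe (pe (pe (pe e n0) (entry (psnd j) n0)) x) y \<in> R"
        using that unfolding total_iff Q_def by blast
      then show False using n0 by blast
    qed
    have "infinite (- P.total e)"
    proof
      assume fin: "finite (- P.total e)"
      have "range (pe n0) \<subseteq> - P.total e" using total_less by force
      moreover have "infinite (range (pe n0))" by (intro range_inj_infinite) (simp add: inj_def)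
      ultimately show False using fin finite_subset by blast
    qed
    note only = P.acts_only_total[OF this]
    define Tot where "Tot = {i. i < n0 \<and> (\<forall>x. \<exists>t. conv i x t)}"
    \<comment> \<open>At most \<open>Suc m\<close> indices contribute at \<open>m\<close>, each with
      a value bounded by the sum. The finite set \<open>Tot\<close> need not be found from
      \<open>e\<close>, as \<open>p\<close> only has to exist.\<close>
    define p where "p m = Suc m * (\<Sum>i\<in>Tot. val i (m - 1) (ctime i (m - 1)))" for m
    have p: "recursive p"
    proof -
      have "finite Tot" by (simp add: Tot_def)
      moreover have "\<forall>i\<in>Tot. \<forall>x. \<exists>t. conv i x t" by (simp add: Tot_def)
      ultimately have "recursive (\<lambda>m. \<Sum>i\<in>Tot. val i (m - 1) (ctime i (m - 1)))"
      proof (induction Tot rule: finite_induct)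
        case empty show ?case by (simp add: rec_intros)
      next
        case (insert i F)
        then have "recursive (\<lambda>m. \<Sum>i\<in>F. val i (m - 1) (ctime i (m - 1)))" "recursive (ctime i)"
          using recursive_ctime by simp_all
        note r = this(1) recursive_comp[OF this(2)]
        have "recursive (\<lambda>m. val i (m - 1) (ctime i (m - 1)) + (\<Sum>i\<in>F. val i (m - 1) (ctime i (m - 1))))"
          by (intro rec_intros r)
        then show ?case using insert by simp
      qed
      then show ?thesis unfolding p_def by (intro rec_intros)
    qed
    have "\<exists>m\<ge>b. \<forall>s. g e m s \<le> p m" for b
    proof -
      obtain m where m: "m \<ge> Suc b" "\<And>j s. acts (c e) j m s \<Longrightarrow> j \<in> P.total e" using only by blast
      have "g e m s \<le> p m" for s
      proof -
        have "g e m s \<le> (\<Sum>j\<le>m. \<Sum>i\<in>Tot. val i (m - 1) (ctime i (m - 1)))"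
          unfolding g_def
        proof (intro sum_mono)
          fix j
          show "(if \<exists>t\<le>s. acts (c e) j m t then val (pfst j) (m - 1) s else 0)
            \<le> (\<Sum>i\<in>Tot. val i (m - 1) (ctime i (m - 1)))"
          proof (cases "\<exists>t\<le>s. acts (c e) j m t")
            case True
            then have j: "j \<in> P.total e" using m by blast
            then have "pfst j \<in> Tot" using total_less unfolding Tot_def total_iff Q_def by blast
            then have "val (pfst j) (m - 1) (ctime (pfst j) (m - 1)) \<le> (\<Sum>i\<in>Tot. val i (m - 1) (ctime i (m - 1)))"
              by (intro member_le_sum[of "pfst j" Tot "\<lambda>i. val i (m - 1) (ctime i (m - 1))"]) (auto simp: Tot_def)
            then show ?thesis using val_le_limit[of "pfst j" "m - 1" s] True by auto
          next
            case False
            show ?thesis unfolding if_not_P[OF False] by simp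
          qed
        qed
        also have "\<dots> = p m" by (simp add: p_def)
        finally show ?thesis .
      qed
      then show ?thesis using m(1) by (meson Suc_leD)
    qed
    then show "\<exists>p. recursive p \<and> (\<forall>b. \<exists>m\<ge>b. \<forall>s. g e m s \<le> p m)" using p by blast
  qed
qed

end

section \<open>The leftmost sequence\<close>

definition bits :: "nat \<Rightarrow> nat \<Rightarrow> bool list" where
  "bits l v = rec_nat [] (\<lambda>j r. odd (v div 2 ^ j) # r) l"

lemma bits_0 [simp]: "bits 0 v = []"
  and bits_Suc: "bits (Suc l) v = odd (v div 2 ^ l) # bits l v"
  by (simp_all add: bits_def)

lemma bits_snoc: "bits (Suc l) v = bits l (v div 2) @ [odd v]"
proof (induction l)
  case (Suc l)
  then show ?case by (subst (1) bits_Suc, subst Suc) (simp add: bits_Suc div_mult2_eq)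
qed (simp add: bits_Suc)

lemma bits_child: "bits l v @ [b] = bits (Suc l) (2 * v + of_bool b)"
  by (cases b) (simp_all add: bits_snoc)

lemma recursive_string_code_bits [rec_intros]:
  assumes "recursive f" "recursive g"
  shows "recursive (\<lambda>x. string_code (bits (f x) (g x)))"
proof -
  have eq: "string_code (bits l v) = rec_nat 0 (\<lambda>j r. Suc (pe ((v div 2 ^ j) mod 2) r)) l" for l v
    by (induction l) (simp_all add: string_code_def bits_Suc odd_iff_mod_2_eq_one of_bool_def)
  show ?thesis unfolding eq by (intro rec_intros assms assms[THEN recursive_comp])
qed

lemma less_exp_Suc: "n < 2 ^ Suc n" for n :: nat
  using less_exp[of n] unfolding power_Suc by linarith

text \<open>Block \<open>m\<close> runs from position \<open>2 ^ m\<close> up to but excluding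
  \<open>2 ^ Suc m\<close>. Position 0 lies in no block although \<open>blk 0 = 0\<close>;
  \<open>lpath\<close> puts the bit 0 there.\<close>

definition blk :: "nat \<Rightarrow> nat" where "blk l = (LEAST m. l < 2 ^ Suc m)"

lemma recursive_blk [rec_intros]:
  assumes "recursive f" shows "recursive (\<lambda>x. blk (f x))"
  unfolding blk_def
proof (intro recursive_Least rec_intros assms[THEN recursive_comp])
  show "\<exists>m. f x < 2 ^ Suc m" for x using less_exp_Suc by blast
qed

lemma blk_eq: "2 ^ m \<le> l \<Longrightarrow> l < 2 ^ Suc m \<Longrightarrow> blk l = m"
  unfolding blk_def
proof (rule Least_equality)
  fix k :: nat assume "2 ^ m \<le> l" "l < 2 ^ Suc k"
  then have "(2::nat) ^ m < 2 ^ Suc k" by simp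
  then show "m \<le> k" by (simp only: power_strict_increasing_iff)
qed

lemma less_exp_blk: "l < 2 ^ Suc (blk l)"
  unfolding blk_def by (rule LeastI[of _ l]) (rule less_exp_Suc)

lemma blk_le: "blk l \<le> l"
  unfolding blk_def by (rule Least_le) (rule less_exp_Suc)

text \<open>A supermartingale with initial capital at most \<open>2 ^ m\<close> has at most
  \<open>2 ^ 2 ^ m * 2 ^ m\<close> at length \<open>2 ^ m\<close>; dividing by
  \<open>2 ^ wexp m\<close> leaves at most \<open>1 / 2 ^ m\<close>.\<close>

definition wexp :: "nat \<Rightarrow> nat" where "wexp n = 2 ^ n + 2 * n"

lemma wexp_mono: "n \<le> m \<Longrightarrow> wexp n \<le> wexp m"
  unfolding wexp_def by (intro add_mono mult_left_mono power_increasing) auto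

lemma recursive_wexp [rec_intros]: "recursive f \<Longrightarrow> recursive (\<lambda>x. wexp (f x))"
  unfolding wexp_def by (intro rec_intros)

text \<open>
  \<open>D n l v / 2 ^ l\<close> is the capital of the \<open>n\<close>-th supermartingale on the string of length \<open>l\<close> and
  binary value \<open>v\<close>. In block \<open>m\<close>, the positions from \<open>2 ^ m\<close> on, those with \<open>n \<in> S\<close> count with
  weight \<open>1 / 2 ^ wexp n\<close>, and \<open>over\<close> says that the total exceeds \<open>2 - 1 / 2 ^ m\<close>. The predicate is
  stated over \<open>nat\<close> in order to be decidable.
\<close>

definition over :: "(nat \<Rightarrow> nat \<Rightarrow> nat \<Rightarrow> nat) \<Rightarrow> (nat \<Rightarrow> bool) \<Rightarrow> nat \<Rightarrow> nat \<Rightarrow> nat \<Rightarrow> bool" where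
  "over D S m l v \<longleftrightarrow> (2 ^ Suc m - 1) * 2 ^ (l + 2 ^ m + m) <
     (\<Sum>n\<le>m. if S n then D n l v * 2 ^ (wexp m - wexp n) else 0)"

definition capital :: "(nat \<Rightarrow> nat \<Rightarrow> nat \<Rightarrow> nat) \<Rightarrow> (nat \<Rightarrow> bool) \<Rightarrow> nat \<Rightarrow> nat \<Rightarrow> nat \<Rightarrow> real" where
  "capital D S m l v = (\<Sum>n\<le>m. if S n then real (D n l v) / 2 ^ l / 2 ^ wexp n else 0)"

lemma over_iff: "over D S m l v \<longleftrightarrow> 2 - 1 / 2 ^ m < capital D S m l v"
proof -
  have R: "real (\<Sum>n\<le>m. if S n then D n l v * 2 ^ (wexp m - wexp n) else 0) = 2 ^ (l + wexp m) * capital D S m l v"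
    unfolding capital_def of_nat_sum sum_distrib_left
  proof (intro sum.cong refl)
    fix n assume "n \<in> {..m}"
    then have "wexp n \<le> wexp m" using wexp_mono by simp
    then have "(2::real) ^ (wexp m - wexp n) = 2 ^ wexp m / 2 ^ wexp n" by (simp add: power_diff)
    then show "real (if S n then D n l v * 2 ^ (wexp m - wexp n) else 0) =
        2 ^ (l + wexp m) * (if S n then real (D n l v) / 2 ^ l / 2 ^ wexp n else 0)"
      by (simp add: power_add)
  qed
  have "l + wexp m = (l + 2 ^ m + m) + m" by (simp add: wexp_def)
  then have Z: "(2::real) ^ (l + wexp m) = 2 ^ (l + 2 ^ m + m) * 2 ^ m" by (simp only: power_add)
  have "real (2 ^ Suc m - 1) = 2 ^ m * (2 - 1 / 2 ^ m)" by (simp add: of_nat_diff right_diff_distrib)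
  then have L: "real ((2 ^ Suc m - 1) * 2 ^ (l + 2 ^ m + m)) = 2 ^ (l + wexp m) * (2 - 1 / 2 ^ m)"
    unfolding Z of_nat_mult of_nat_power of_nat_numeral by (simp only: mult.commute mult.left_commute)
  have "over D S m l v \<longleftrightarrow> real ((2 ^ Suc m - 1) * 2 ^ (l + 2 ^ m + m)) <
      real (\<Sum>n\<le>m. if S n then D n l v * 2 ^ (wexp m - wexp n) else 0)"
    unfolding over_def by (simp only: of_nat_less_iff)
  also have "\<dots> \<longleftrightarrow> 2 - 1 / 2 ^ m < capital D S m l v" unfolding L R by simp
  finally show ?thesis .
qed

lemma over_mono:
  assumes "over D S m l v" "\<And>n. S n \<Longrightarrow> S' n"
  shows "over D S' m l v"
  using assms(1) unfolding over_def
  by (rule less_le_trans) (use assms(2) in \<open>intro sum_mono, auto\<close>)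

lemma over_cong:
  assumes "\<And>n. n \<le> m \<Longrightarrow> S n = S' n" "\<And>n. n \<le> m \<Longrightarrow> S n \<Longrightarrow> D n l v = D' n l v"
  shows "over D S m l v = over D' S' m l v"
proof -
  have "(\<Sum>n\<le>m. if S n then D n l v * 2 ^ (wexp m - wexp n) else 0) =
    (\<Sum>n\<le>m. if S' n then D' n l v * 2 ^ (wexp m - wexp n) else 0)"
    using assms by (intro sum.cong) auto
  then show ?thesis by (simp add: over_def)
qed

text \<open>The leftmost path along which no block is ever \<open>over\<close>.\<close>

primrec lpath :: "(nat \<Rightarrow> nat \<Rightarrow> nat \<Rightarrow> nat) \<Rightarrow> (nat \<Rightarrow> nat \<Rightarrow> bool) \<Rightarrow> nat \<Rightarrow> nat" where
  "lpath D S 0 = 0"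
| "lpath D S (Suc l) = 2 * lpath D S l +
     (if l = 0 then 0 else of_bool (over D (S (blk l)) (blk l) (Suc l) (2 * lpath D S l)))"

definition pathseq :: "(nat \<Rightarrow> nat \<Rightarrow> nat \<Rightarrow> nat) \<Rightarrow> (nat \<Rightarrow> nat \<Rightarrow> bool) \<Rightarrow> nat \<Rightarrow> bool" where
  "pathseq D S l \<longleftrightarrow> odd (lpath D S (Suc l))"

lemma lpath_Suc_pathseq: "lpath D S (Suc l) = 2 * lpath D S l + of_bool (pathseq D S l)"
  by (simp add: pathseq_def)

lemma lpath_less: "lpath D S l < 2 ^ l"
proof (induction l)
  case (Suc l)
  then show ?case unfolding lpath_Suc_pathseq by (cases "pathseq D S l") simp_all
qed simp

lemma restr_pathseq: "restr (pathseq D S) l = bits l (lpath D S l)"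
proof (induction l)
  case (Suc l)
  have "restr (pathseq D S) (Suc l) = restr (pathseq D S) l @ [pathseq D S l]" by (simp add: restr_def)
  then show ?case unfolding Suc bits_child lpath_Suc_pathseq .
qed (simp add: restr_def)

text \<open>A strict lead in value survives any further bits. On a common prefix, more counted
  indices can only turn \<open>over\<close> from false to true, hence the bit from 0 to 1.\<close>

lemma lpath_mono:
  assumes "\<And>m n. S m n \<Longrightarrow> S' m n"
  shows "lpath D S l \<le> lpath D S' l"
proof (induction l)
  case (Suc l)
  consider "lpath D S l < lpath D S' l" | "lpath D S l = lpath D S' l" using Suc by linarith
  then show ?case
  proof cases
    case 1
    then show ?thesis unfolding lpath_Suc_pathseq
      by (cases "pathseq D S l"; cases "pathseq D S' l") simp_all
  next
    case 2
    then show ?thesis using over_mono[of D "S (blk l)" "blk l" "Suc l" _ "S' (blk l)"] assms by simp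
  qed
qed simp

lemma lpath_cong:
  assumes "\<And>m n. m \<le> l \<Longrightarrow> n \<le> m \<Longrightarrow> S m n = S' m n"
  shows "lpath D S l = lpath D S' l"
  using assms
proof (induction l)
  case (Suc l)
  then have IH: "lpath D S l = lpath D S' l" by simp
  have "over D (S (blk l)) (blk l) (Suc l) v = over D (S' (blk l)) (blk l) (Suc l) v" for v
    using Suc.prems blk_le[of l] by (intro over_cong) auto
  then show ?case using IH by simp
qed simp

text \<open>
  An index \<open>n\<close> must be active throughout the blocks from \<open>n\<close> on, so from block to block the
  only new contribution is that of \<open>n = Suc m\<close>, which is at most \<open>1 / 2 ^ Suc m\<close>.
\<close>

lemma capital_path:
  assumes persist: "\<And>m n. n \<le> m \<Longrightarrow> S (Suc m) n \<Longrightarrow> S m n"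
    and super: "\<And>m n l v. n \<le> m \<Longrightarrow> S m n \<Longrightarrow> l < 2 ^ Suc m \<Longrightarrow> v < 2 ^ l \<Longrightarrow>
       D n (Suc l) (2 * v) + D n (Suc l) (2 * v + 1) \<le> 4 * D n l v"
    and init: "\<And>m n. n \<le> m \<Longrightarrow> S m n \<Longrightarrow> D n 0 0 \<le> 2 ^ n"
    and r: "r \<le> 2 ^ m"
  shows "capital D (S m) m (2 ^ m + r) (lpath D S (2 ^ m + r)) \<le> 2 - 1 / 2 ^ m"
proof -
  have D_bound: "D n l v \<le> 4 ^ l * 2 ^ n" if "n \<le> m" "S m n" "l \<le> 2 ^ Suc m" "v < 2 ^ l" for m n l v
    using that(3,4)
  proof (induction l arbitrary: v)
    case 0
    then show ?case using init[OF that(1,2)] by simp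
  next
    case (Suc l)
    have "D n l (v div 2) \<le> 4 ^ l * 2 ^ n" using Suc by (intro Suc.IH) auto
    moreover have "D n (Suc l) (2 * (v div 2)) + D n (Suc l) (2 * (v div 2) + 1) \<le> 4 * D n l (v div 2)"
      using Suc.prems by (intro super[OF that(1,2)]) auto
    moreover have "D n (Suc l) v \<le> D n (Suc l) (2 * (v div 2)) + D n (Suc l) (2 * (v div 2) + 1)"
      by (cases "even v") simp_all
    ultimately have "D n (Suc l) v \<le> 4 * (4 ^ l * 2 ^ n)" by linarith
    then show ?case by simp
  qed
  have fresh: "real (D m (2 ^ m) v) / 2 ^ 2 ^ m / 2 ^ wexp m \<le> 1 / 2 ^ m" if "S m m" "v < 2 ^ 2 ^ m" for m v
  proof -
    have "D m (2 ^ m) v \<le> 4 ^ 2 ^ m * 2 ^ m" using that by (intro D_bound) auto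
    then have "real (D m (2 ^ m) v) \<le> real (4 ^ 2 ^ m * 2 ^ m)" by (simp only: of_nat_le_iff)
    moreover have "real (4 ^ 2 ^ m * 2 ^ m) = 1 / 2 ^ m * (2 ^ 2 ^ m * 2 ^ wexp m)"
    proof -
      have "(4::real) ^ 2 ^ m = 2 ^ 2 ^ m * 2 ^ 2 ^ m" by (simp add: power_mult_distrib[symmetric])
      then show ?thesis by (simp add: wexp_def power_add mult_2)
    qed
    ultimately have le: "real (D m (2 ^ m) v) \<le> 1 / 2 ^ m * (2 ^ 2 ^ m * 2 ^ wexp m)" by linarith
    show ?thesis unfolding divide_divide_eq_left by (rule mult_imp_div_pos_le[OF _ le]) simp
  qed
  \<comment> \<open>The capitals of the two children average to at most that of the parent, so if
    the left child exceeds the threshold, the right one does not.\<close>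
  have step: "capital D (S m) m (Suc l) (lpath D S (Suc l)) \<le> 2 - 1 / 2 ^ m"
    if l: "2 ^ m \<le> l" "l < 2 ^ Suc m" and IH: "capital D (S m) m l (lpath D S l) \<le> 2 - 1 / 2 ^ m" for m l
  proof -
    let ?v = "lpath D S l"
    have "capital D (S m) m (Suc l) (2 * ?v) + capital D (S m) m (Suc l) (2 * ?v + 1) \<le> 2 * capital D (S m) m l ?v"
      unfolding capital_def sum_distrib_left sum.distrib[symmetric]
    proof (intro sum_mono)
      fix n assume n: "n \<in> {..m}"
      show "(if S m n then real (D n (Suc l) (2 * ?v)) / 2 ^ Suc l / 2 ^ wexp n else 0) +
            (if S m n then real (D n (Suc l) (2 * ?v + 1)) / 2 ^ Suc l / 2 ^ wexp n else 0)
         \<le> 2 * (if S m n then real (D n l ?v) / 2 ^ l / 2 ^ wexp n else 0)"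
      proof (cases "S m n")
        case True
        have "D n (Suc l) (2 * ?v) + D n (Suc l) (2 * ?v + 1) \<le> 4 * D n l ?v"
          using super[OF _ True l(2) lpath_less] n by simp
        then have "real (D n (Suc l) (2 * ?v) + D n (Suc l) (2 * ?v + 1)) \<le> real (4 * D n l ?v)"
          by (simp only: of_nat_le_iff)
        then have "real (D n (Suc l) (2 * ?v)) + real (D n (Suc l) (2 * ?v + 1)) \<le> 4 * real (D n l ?v)"
          by simp
        then have "(real (D n (Suc l) (2 * ?v)) + real (D n (Suc l) (2 * ?v + 1))) / (2 ^ Suc l * 2 ^ wexp n)
            \<le> 4 * real (D n l ?v) / (2 ^ Suc l * 2 ^ wexp n)"
          by (rule divide_right_mono) simp
        then show ?thesis using True by (simp add: add_divide_distrib)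
      qed simp
    qed
    moreover have "blk l = m" "l \<noteq> 0" using l by (auto intro: blk_eq)
    ultimately show ?thesis using IH
      by (cases "over D (S m) m (Suc l) (2 * ?v)") (simp_all add: over_iff)
  qed
  have inner: "capital D (S m) m (2 ^ m + r) (lpath D S (2 ^ m + r)) \<le> 2 - 1 / 2 ^ m"
    if "capital D (S m) m (2 ^ m) (lpath D S (2 ^ m)) \<le> 2 - 1 / 2 ^ m" "r \<le> 2 ^ m" for m r
    using that(2)
  proof (induction r)
    case (Suc r)
    then show ?case using step[of m "2 ^ m + r"] by simp
  qed (use that(1) in simp)
  have outer: "capital D (S m) m (2 ^ m) (lpath D S (2 ^ m)) \<le> 2 - 1 / 2 ^ m" for m
  proof (induction m)
    case 0
    have "capital D (S 0) 0 1 0 = (if S 0 0 then real (D 0 1 0) / 2 ^ 1 / 2 ^ wexp 0 else 0)"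
      unfolding capital_def atMost_0 by (subst sum.insert) simp_all
    then show ?case using fresh[of 0 0] by simp
  next
    case (Suc m)
    let ?v = "lpath D S (2 ^ Suc m)"
    have "capital D (S (Suc m)) (Suc m) (2 ^ Suc m) ?v =
      (\<Sum>n\<le>m. if S (Suc m) n then real (D n (2 ^ Suc m) ?v) / 2 ^ 2 ^ Suc m / 2 ^ wexp n else 0) +
      (if S (Suc m) (Suc m) then real (D (Suc m) (2 ^ Suc m) ?v) / 2 ^ 2 ^ Suc m / 2 ^ wexp (Suc m) else 0)"
      unfolding capital_def by (rule sum.atMost_Suc)
    also have "\<dots> \<le> capital D (S m) m (2 ^ Suc m) ?v + 1 / 2 ^ Suc m"
    proof (rule add_mono)
      show "(\<Sum>n\<le>m. if S (Suc m) n then real (D n (2 ^ Suc m) ?v) / 2 ^ 2 ^ Suc m / 2 ^ wexp n else 0)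
        \<le> capital D (S m) m (2 ^ Suc m) ?v"
        unfolding capital_def using persist by (intro sum_mono) auto
      show "(if S (Suc m) (Suc m) then real (D (Suc m) (2 ^ Suc m) ?v) / 2 ^ 2 ^ Suc m / 2 ^ wexp (Suc m) else 0)
        \<le> 1 / 2 ^ Suc m" using fresh[of "Suc m" ?v] lpath_less by auto
    qed
    also have "capital D (S m) m (2 ^ Suc m) ?v \<le> 2 - 1 / 2 ^ m"
      using inner[OF Suc, of "2 ^ m"] by (simp add: mult_2)
    finally show ?case by simp
  qed
  show ?thesis by (rule inner[OF outer r])
qed

section \<open>Supermartingales recognised within a time bound\<close>

context enumeration
begin

text \<open>The index \<open>n\<close> stands for the function with index \<open>pfst n\<close>, so each function has arbitrarily large ones.\<close>

definition good :: "nat \<Rightarrow> nat \<Rightarrow> nat \<Rightarrow> bool" where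
  "good n m t \<longleftrightarrow> (\<forall>l\<le>2 ^ Suc m. \<forall>v<2 ^ l. conv (pfst n) (pe l v) t) \<and>
     val (pfst n) (pe 0 0) t \<le> 2 ^ n \<and>
     (\<forall>l<2 ^ Suc m. \<forall>v<2 ^ l. val (pfst n) (pe (Suc l) (2 * v)) t +
        val (pfst n) (pe (Suc l) (2 * v + 1)) t \<le> 4 * val (pfst n) (pe l v) t)"

definition limval :: "nat \<Rightarrow> nat \<Rightarrow> nat \<Rightarrow> nat" where
  "limval n l v = val (pfst n) (pe l v) (ctime (pfst n) (pe l v))"

text \<open>Requiring all blocks from \<open>n\<close> to \<open>m\<close> makes activity pass down
  to the earlier ones among these blocks, as \<open>capital_path\<close> demands.\<close>

definition active :: "(nat \<Rightarrow> nat) \<Rightarrow> nat \<Rightarrow> nat \<Rightarrow> bool" where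
  "active u m n \<longleftrightarrow> n \<le> m \<and> (\<forall>k\<le>m. n \<le> k \<longrightarrow> good n k (u k))"

lemma conv_limval: "conv (pfst n) (pe l v) t \<Longrightarrow> val (pfst n) (pe l v) t = limval n l v"
  unfolding limval_def using conv_ctime val_stable by blast

lemma good_limval:
  "good n m t \<Longrightarrow> l \<le> 2 ^ Suc m \<Longrightarrow> v < 2 ^ l \<Longrightarrow> val (pfst n) (pe l v) t = limval n l v"
  unfolding good_def using conv_limval by blast

lemma good_super:
  assumes "good n m t" "l < 2 ^ Suc m" "v < 2 ^ l"
  shows "limval n (Suc l) (2 * v) + limval n (Suc l) (2 * v + 1) \<le> 4 * limval n l v"
proof -
  have "val (pfst n) (pe (Suc l) (2 * v)) t + val (pfst n) (pe (Suc l) (2 * v + 1)) t \<le> 4 * val (pfst n) (pe l v) t"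
    using assms unfolding good_def by blast
  then show ?thesis using assms by (simp add: good_limval[OF assms(1)])
qed

lemma good_init: "good n m t \<Longrightarrow> limval n 0 0 \<le> 2 ^ n"
  using good_limval[of n m t 0 0] unfolding good_def by simp

text \<open>Values do not change once converged, so tests passed at stage \<open>s\<close> have the
  same outcome at \<open>t\<close>.\<close>

lemma good_mono:
  assumes "good n m s" "s \<le> t"
  shows "good n m t"
proof -
  have c: "conv (pfst n) (pe l v) t" if "l \<le> 2 ^ Suc m" "v < 2 ^ l" for l v
    using assms that conv_mono unfolding good_def by blast
  have v: "val (pfst n) (pe l v) t = limval n l v" if "l \<le> 2 ^ Suc m" "v < 2 ^ l" for l v
    using conv_limval[OF c] that by blast
  show ?thesis unfolding good_def
  proof (intro conjI allI impI)
    show "val (pfst n) (pe 0 0) t \<le> 2 ^ n" using v[of 0 0] good_init[OF assms(1)] by simp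
    fix l v :: nat assume lv: "l < 2 ^ Suc m" "v < 2 ^ l"
    then show "val (pfst n) (pe (Suc l) (2 * v)) t + val (pfst n) (pe (Suc l) (2 * v + 1)) t \<le> 4 * val (pfst n) (pe l v) t"
      using good_super[OF assms(1) lv] v[of "Suc l"] v[of l] by simp
  qed (use c in blast)
qed

lemma active_mono: "active u m n \<Longrightarrow> (\<And>k. u k \<le> w k) \<Longrightarrow> active w m n"
  unfolding active_def using good_mono by blast

lemma decidable_good [rec_intros]:
  assumes "recursive f" "recursive g" "recursive h"
  shows "decidable (\<lambda>x. good (f x) (g x) (h x))"
  unfolding good_def by (intro rec_intros assms assms[THEN recursive_comp])

abbreviation apath :: "(nat \<Rightarrow> nat) \<Rightarrow> nat \<Rightarrow> nat" where
  "apath u \<equiv> lpath limval (active u)"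

text \<open>\<open>limval\<close> need not be recursive, but an active index has converged by stage
  \<open>u (blk l)\<close> on everything consulted. Using stage values instead makes the path
  computable from \<open>u\<close>.\<close>

lemma apath_eq_rec_nat:
  "apath u l = rec_nat 0 (\<lambda>l p. 2 * p + (if l = 0 then 0 else
     of_bool (over (\<lambda>n k v. val (pfst n) (pe k v) (u (blk l))) (active u (blk l)) (blk l) (Suc l) (2 * p)))) l"
proof (induction l)
  case (Suc l)
  have "over limval (active u (blk l)) (blk l) (Suc l) (2 * apath u l) =
    over (\<lambda>n k v. val (pfst n) (pe k v) (u (blk l))) (active u (blk l)) (blk l) (Suc l) (2 * apath u l)"
  proof (rule over_cong)
    fix n assume "active u (blk l) n"
    then have "good n (blk l) (u (blk l))" by (auto simp: active_def)
    then show "limval n (Suc l) (2 * apath u l) = val (pfst n) (pe (Suc l) (2 * apath u l)) (u (blk l))"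
      using good_limval[of n "blk l" "u (blk l)" "Suc l" "2 * apath u l"] less_exp_blk[of l] lpath_less[of limval "active u" l]
      by simp
  qed simp
  then show ?case using Suc by simp
qed simp

lemma recursive_apath:
  assumes u: "\<And>a b. recursive a \<Longrightarrow> recursive b \<Longrightarrow> recursive (\<lambda>x. u (a x) (b x))"
    and "recursive f" "recursive h"
  shows "recursive (\<lambda>x. apath (u (f x)) (h x))"
  unfolding apath_eq_rec_nat over_def active_def
  by (intro rec_intros u assms(2,3) assms(2,3)[THEN recursive_comp])

end

section \<open>Computable randomness\<close>

lemma three_mult_less_exp: "3 * m + 1 \<le> 2 ^ m" if "4 \<le> m" for m :: nat
  using that by (induction m rule: dec_induct) simp_all

lemma set_encode_less: "A \<subseteq> {..m} \<Longrightarrow> set_encode A < 2 ^ Suc m"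
proof -
  assume A: "A \<subseteq> {..m}"
  have "set_encode A \<le> (\<Sum>n\<le>m. 2 ^ n)" unfolding set_encode_def using A by (intro sum_mono2) auto
  also have "\<dots> < 2 ^ Suc m" by (induction m) auto
  finally show ?thesis .
qed

section \<open>Decoding strings; martingales with dyadic values\<close>

definition strval :: "bool list \<Rightarrow> nat" where
  "strval \<sigma> = foldl (\<lambda>v b. 2 * v + of_bool b) 0 \<sigma>"

lemma strval_snoc [simp]: "strval (\<sigma> @ [b]) = 2 * strval \<sigma> + of_bool b"
  by (simp add: strval_def)

lemma strval_bits: "v < 2 ^ l \<Longrightarrow> strval (bits l v) = v"
proof (induction l arbitrary: v)
  case (Suc l)
  then have "strval (bits l (v div 2)) = v div 2" by (intro Suc.IH) auto
  then show ?case by (cases "even v") (auto simp: bits_snoc elim!: evenE oddE)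
qed (simp add: strval_def)

lemma strval_restr_pathseq: "strval (restr (pathseq D S) l) = lpath D S l"
  by (simp add: restr_pathseq strval_bits lpath_less)

text \<open>The state holds the unread part of a code and the length and value read so far. The end
  of the string is a fixed point, so iterating too often is harmless.\<close>

definition scan :: "nat \<Rightarrow> nat" where
  "scan s = (if pfst s = 0 then s else
     pe (psnd (pfst s - 1)) (pe (Suc (pfst (psnd s))) (2 * psnd (psnd s) + pfst (pfst s - 1))))"

lemma recursive_scan [rec_intros]: "recursive f \<Longrightarrow> recursive (\<lambda>x. scan (f x))"
  unfolding scan_def by (intro rec_intros)

lemma rec_nat_shift: "rec_nat s (\<lambda>_ r. F r) (Suc n) = rec_nat (F s) (\<lambda>_ r. F r) n"
  by (induction n) simp_all

lemma scan_iterate: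
  "length \<sigma> \<le> n \<Longrightarrow> rec_nat (pe (string_code \<sigma>) (pe l v)) (\<lambda>_ r. scan r) n =
     pe 0 (pe (l + length \<sigma>) (foldl (\<lambda>v b. 2 * v + of_bool b) v \<sigma>))"
proof (induction \<sigma> arbitrary: l v n)
  case Nil
  show ?case by (induction n) (simp_all add: string_code_def scan_def)
next
  case (Cons b \<sigma>)
  then obtain n' where n': "n = Suc n'" "length \<sigma> \<le> n'" by (cases n) auto
  have "scan (pe (string_code (b # \<sigma>)) (pe l v)) = pe (string_code \<sigma>) (pe (Suc l) (2 * v + of_bool b))"
    by (simp add: scan_def string_code_def)
  then show ?case unfolding n'(1) rec_nat_shift using Cons.IH[OF n'(2)] by simp
qed

lemma length_le_string_code: "length \<sigma> \<le> string_code \<sigma>"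
proof (induction \<sigma>)
  case (Cons b \<sigma>)
  have "string_code \<sigma> \<le> pe (of_bool b) (string_code \<sigma>)" by (rule le_prod_encode_2)
  then show ?case using Cons by (simp add: string_code_def)
qed simp

lemma string_code_decoder:
  obtains dl dv where "recursive dl" "recursive dv"
    "\<And>\<sigma>. dl (string_code \<sigma>) = length \<sigma>" "\<And>\<sigma>. dv (string_code \<sigma>) = strval \<sigma>"
proof -
  let ?s = "\<lambda>x. rec_nat (pe x (pe 0 0)) (\<lambda>_ r. scan r) x"
  have s: "recursive ?s" by (intro rec_intros)
  have eq: "?s (string_code \<sigma>) = pe 0 (pe (length \<sigma>) (strval \<sigma>))" for \<sigma>
    using scan_iterate[OF length_le_string_code, of \<sigma> 0 0] by (simp add: strval_def)
  show thesis
  proof (rule that[of "\<lambda>x. pfst (psnd (?s x))" "\<lambda>x. psnd (psnd (?s x))"])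
    show "recursive (\<lambda>x. pfst (psnd (?s x)))" "recursive (\<lambda>x. psnd (psnd (?s x)))"
      by (intro recursive_fst recursive_snd s)+
  qed (simp_all only: eq prod_encode_inverse fst_conv snd_conv)
qed

text \<open>Dyadic values with computable numerators are obtained exactly, so one rational serves
  for every precision.\<close>

lemma recursive_martingaleI:
  assumes a: "\<And>f g. recursive f \<Longrightarrow> recursive g \<Longrightarrow> recursive (\<lambda>x. a (f x) (g x))"
    and c: "\<And>f. recursive f \<Longrightarrow> recursive (\<lambda>x. c (f x))"
    and M: "\<And>\<sigma>. M \<sigma> = real (a (length \<sigma>) (strval \<sigma>)) / 2 ^ c (length \<sigma>)"
    and "martingale M"
  shows "recursive_martingale M"
proof -
  obtain dl dv where d: "recursive dl" "recursive dv"
    "\<And>\<sigma>. dl (string_code \<sigma>) = length \<sigma>" "\<And>\<sigma>. dv (string_code \<sigma>) = strval \<sigma>"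
    by (rule string_code_decoder) blast
  define q :: "nat \<Rightarrow> rat" where "q n = (of_nat (a (dl (pfst n)) (dv (pfst n))) - of_nat 0) /
     of_nat (Suc (2 ^ c (dl (pfst n)) - 1))" for n
  have "recursive_rat_seq q" unfolding recursive_rat_seq_def
  proof (intro exI conjI allI)
    show "recursive (\<lambda>n. a (dl (pfst n)) (dv (pfst n)))" "recursive (\<lambda>n. 0)"
      "recursive (\<lambda>n. 2 ^ c (dl (pfst n)) - 1)"
      by (intro a c rec_intros d(1,2)[THEN recursive_comp])+
  qed (rule q_def)
  moreover have "real_of_rat (q (pe (string_code \<sigma>) k)) = M \<sigma>" for \<sigma> k
    unfolding q_def prod_encode_inverse fst_conv d(3,4) M by (simp add: of_rat_divide of_rat_power)
  ultimately show ?thesis unfolding recursive_martingale_def using assms(4) by auto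
qed

section \<open>Numbers with two binary expansions\<close>

lemma double_mod_power2:
  "(2 * v + of_bool b) mod 2 ^ Suc k = 2 * (v mod 2 ^ k) + of_bool b" for v :: nat
  by (cases b) (simp_all add: mod_mult2_eq)

text \<open>From position \<open>N\<close> on, betting everything on \<open>b\<close> doubles the
  capital at each bit.\<close>

lemma eventually_constant_not_schnorr:
  assumes X: "\<And>n. n \<ge> N \<Longrightarrow> X n = b"
  shows "\<not> schnorr_random X"
proof -
  \<comment> \<open>The residue is compared with the number whose \<open>l - N\<close> binary digits
    all equal \<open>b\<close>; for \<open>l \<le> N\<close> the test holds trivially and the
    capital is 1.\<close>
  define a :: "nat \<Rightarrow> nat \<Rightarrow> nat" where "a l v = (if v mod 2 ^ (l - N) = of_bool b * (2 ^ (l - N) - 1) then 2 ^ (l - N) else 0)" for l v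
  define M where "M \<sigma> = real (a (length \<sigma>) (strval \<sigma>))" for \<sigma>
  have a_rec: "recursive (\<lambda>x. a (f x) (g x))" if "recursive f" "recursive g" for f g
    unfolding a_def by (intro rec_intros that)
  have child: "a l v * 2 = a (Suc l) (2 * v) + a (Suc l) (2 * v + 1)" for l v
  proof (cases "l < N")
    case False
    then have k: "Suc l - N = Suc (l - N)" by simp
    define k where "k = l - N"
    define x where "x = v mod 2 ^ k"
    obtain p where p: "(2::nat) ^ k = Suc p" using not0_implies_Suc by (metis power_not_zero zero_neq_numeral)
    have "2 * v mod 2 ^ Suc k = 2 * x" "(2 * v + 1) mod 2 ^ Suc k = 2 * x + 1"
      using double_mod_power2[of v False k] double_mod_power2[of v True k] by (simp_all add: x_def)
    moreover have "v mod Suc p = x" by (simp only: x_def p)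
    \<comment> \<open>For \<open>b\<close> true the winning residue of the next length is
      \<open>2 * p + 1\<close>, which the even child cannot match.\<close>
    moreover have "2 * x \<noteq> 2 * p + 1" by presburger
    ultimately show ?thesis
      unfolding a_def k k_def[symmetric] power_Suc[of 2 k] p by (cases b) auto
  qed (simp add: a_def)
  have "real (a l v) * 2 = real (a (Suc l) (2 * v)) + real (a (Suc l) (2 * v + 1))" for l v
    using arg_cong[OF child[of l v], of real] by simp
  then have "martingale M"
    unfolding martingale_def M_def by (simp flip: add_divide_distrib add: eq_divide_eq)
  then have M: "recursive_martingale M"
    by (intro recursive_martingaleI[of a "\<lambda>_. 0"] a_rec rec_intros) (simp_all add: M_def)
  have val: "a (N + k) (strval (restr X (N + k))) = 2 ^ k" for k
  proof -
    have "strval (restr X (N + k)) mod 2 ^ k = of_bool b * (2 ^ k - 1)"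
    proof (induction k)
      case (Suc k)
      have "restr X (N + Suc k) = restr X (N + k) @ [b]" using X[of "N + k"] by (simp add: restr_def)
      then have "strval (restr X (N + Suc k)) = 2 * strval (restr X (N + k)) + of_bool b" by simp
      moreover have "2 * (2 ^ k - 1) + 1 = 2 ^ Suc k - (1::nat)"
        using one_le_power[of "2::nat" k] unfolding power_Suc by linarith
      ultimately show ?case using Suc double_mod_power2[of "strval (restr X (N + k))" b k]
        by (cases b) simp_all
    qed simp
    then show ?thesis by (simp add: a_def)
  qed
  have "{N..} \<subseteq> {n. real (n - N) \<le> M (restr X n)}"
  proof
    fix n assume "n \<in> {N..}"
    then obtain k where n: "n = N + k" using le_Suc_ex by auto
    have "M (restr X n) = 2 ^ k" using val[of k] by (simp add: M_def n restr_def)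
    moreover have "real k \<le> 2 ^ k" using of_nat_mono[OF less_imp_le[OF less_exp[of k]], where ?'a=real] by simp
    ultimately show "n \<in> {n. real (n - N) \<le> M (restr X n)}" by (simp add: n)
  qed
  then have "infinite {n. real (n - N) \<le> M (restr X n)}"
    using infinite_Ici finite_subset by blast
  moreover have "recursive (\<lambda>n. n - N)" by (intro rec_intros)
  moreover have "mono (\<lambda>n. n - N)" by (intro monoI diff_le_mono)
  moreover have "\<forall>b. \<exists>n. b \<le> n - N" using le_add_diff_inverse2 by (metis add_diff_cancel_right' le_refl)
  ultimately show ?thesis using M unfolding schnorr_random_def by blast
qed

lemma summable_real_of_seq: "summable (\<lambda>n. of_bool (X n) / 2 ^ Suc n :: real)"
proof (rule summable_comparison_test'[of "\<lambda>n. (1/2) ^ Suc n" 0])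
  show "summable (\<lambda>n. (1/2::real) ^ Suc n)" using sums_summable[OF power_half_series] .
qed (simp add: power_divide divide_right_mono)

text \<open>The lead of \<open>Y\<close> at \<open>l\<close> equals the largest amount that the
  later digits can make up, so each of them must contribute its maximum.\<close>

lemma real_of_seq_eq_imp_constant:
  assumes "real_of_seq X = real_of_seq Y" "\<And>n. n < l \<Longrightarrow> X n = Y n" "\<not> X l" "Y l"
  shows "\<forall>n>l. X n \<and> \<not> Y n"
proof -
  let ?t = "\<lambda>X n. of_bool (X n) / 2 ^ Suc n :: real"
  let ?f = "\<lambda>n. 1 / 2 ^ Suc (n + Suc l) - (?t X (n + Suc l) - ?t Y (n + Suc l))"
  have split: "real_of_seq Z = (\<Sum>n. ?t Z (n + Suc l)) + (\<Sum>n<l. ?t Z n) + ?t Z l" for Z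
    unfolding real_of_seq_def by (subst suminf_split_initial_segment[OF summable_real_of_seq, of _ "Suc l"]) simp
  have sm: "summable (\<lambda>n. ?t Z (n + Suc l))" for Z
    using summable_ignore_initial_segment[OF summable_real_of_seq[of Z], of "Suc l"] .
  have "(\<Sum>n<l. ?t X n) = (\<Sum>n<l. ?t Y n)" using assms(2) by (intro sum.cong) auto
  then have diff: "(\<Sum>n. ?t X (n + Suc l)) - (\<Sum>n. ?t Y (n + Suc l)) = 1 / 2 ^ Suc l"
    using assms split[of X] split[of Y] by simp
  have geo: "(\<lambda>n. 1 / 2 ^ Suc (n + Suc l) :: real) sums (1 / 2 ^ Suc l)"
    using sums_divide[OF power_half_series, of "2 ^ Suc l"] by (simp add: power_divide power_add mult_ac)
  have "?f sums (1 / 2 ^ Suc l - ((\<Sum>n. ?t X (n + Suc l)) - (\<Sum>n. ?t Y (n + Suc l))))"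
    by (intro sums_diff geo summable_sums sm)
  then have f: "?f sums 0" unfolding diff by simp
  have nn: "0 \<le> ?f n" for n
    by (cases "X (n + Suc l)"; cases "Y (n + Suc l)") simp_all
  have f0: "?f n = 0" for n
    using suminf_eq_zero_iff[OF sums_summable[OF f] nn] sums_unique[OF f] by simp
  have XY: "X (n + Suc l) \<and> \<not> Y (n + Suc l)" for n
  proof -
    have "1 - (of_bool (X (n + Suc l)) - of_bool (Y (n + Suc l))) = (0::real)"
      using f0[of n] unfolding diff_divide_distrib[symmetric] divide_eq_0_iff by simp
    then show ?thesis by (cases "X (n + Suc l)"; cases "Y (n + Suc l)") simp_all
  qed
  show ?thesis
  proof (intro allI impI)
    fix n assume "l < n"
    then have "n - Suc l + Suc l = n" by simp
    then show "X n \<and> \<not> Y n" using XY[of "n - Suc l"] by simp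
  qed
qed

text \<open>This handles the quantification over expansions in \<open>schnorr_random_real\<close>:
  an expansion other than the constructed one is eventually constant.\<close>

lemma two_expansions_constant:
  assumes eq: "real_of_seq X = real_of_seq Y" and ne: "X \<noteq> Y"
  shows "\<exists>N b. \<forall>n\<ge>N. X n = b"
proof -
  obtain l where l: "X l \<noteq> Y l" "\<And>n. n < l \<Longrightarrow> X n = Y n"
  proof
    have "\<exists>n. X n \<noteq> Y n" using ne by blast
    then show "X (LEAST n. X n \<noteq> Y n) \<noteq> Y (LEAST n. X n \<noteq> Y n)" by (rule LeastI_ex)
    show "X n = Y n" if "n < (LEAST n. X n \<noteq> Y n)" for n using not_less_Least[OF that] by blast
  qed
  have "\<forall>n\<ge>Suc l. X n = Y l"
  proof (cases "Y l")
    case True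
    then have "\<not> X l" using l(1) by blast
    from real_of_seq_eq_imp_constant[OF eq l(2) this True] True show ?thesis by (simp add: Suc_le_eq)
  next
    case False
    then have "X l" using l(1) by blast
    from real_of_seq_eq_imp_constant[OF eq[symmetric] l(2)[symmetric] False this] False
    show ?thesis by (simp add: Suc_le_eq)
  qed
  then show ?thesis by blast
qed

section \<open>Boundedness of recursive martingales on the leftmost path\<close>

context enumeration
begin

lemma active_capital:
  assumes "r \<le> 2 ^ m"
  shows "capital limval (active u m) m (2 ^ m + r) (apath u (2 ^ m + r)) \<le> 2 - 1 / 2 ^ m"
proof (rule capital_path[OF _ _ _ assms])
  show "active u (Suc m) n \<Longrightarrow> n \<le> m \<Longrightarrow> active u m n" for m n by (simp add: active_def)
  have good: "active u m n \<Longrightarrow> good n m (u m)" for m n by (simp add: active_def)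
  show "active u m n \<Longrightarrow> limval n 0 0 \<le> 2 ^ n" for m n using good good_init by blast
  show "active u m n \<Longrightarrow> l < 2 ^ Suc m \<Longrightarrow> v < 2 ^ l \<Longrightarrow>
    limval n (Suc l) (2 * v) + limval n (Suc l) (2 * v + 1) \<le> 4 * limval n l v" for m n l v
    using good good_super by blast
qed

lemma div_bounds:
  assumes "0 < b"
  shows "real (a div b) \<le> real a / real b" "real a / real b - real (a div b) \<le> 1"
proof -
  have "real (a mod b) / real b \<le> 1" using assms by (simp add: less_imp_le)
  moreover have "real a / real b = real (a div b) + real (a mod b) / real b"
    by (rule of_nat_of_nat_div_aux)
  moreover have "0 \<le> real (a mod b) / real b" by simp
  ultimately show "real (a div b) \<le> real a / real b" "real a / real b - real (a div b) \<le> 1"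
    by linarith+
qed

text \<open>
  After scaling by \<open>2 ^ l\<close>, approximating and rounding lose at most \<open>2\<close> and gain at most \<open>1\<close>; adding
  the constant \<open>5\<close> restores the supermartingale inequality.
\<close>

lemma recursive_martingale_majorant:
  assumes "recursive_martingale M"
  obtains d where "recursive d" "\<And>l v. 2 ^ l * M (bits l v) \<le> real (d (pe l v))"
    "\<And>l v. d (pe (Suc l) (2 * v)) + d (pe (Suc l) (2 * v + 1)) \<le> 4 * d (pe l v)"
proof -
  obtain q where M: "martingale M" and q: "recursive_rat_seq q"
    "\<And>\<sigma> k. \<bar>M \<sigma> - real_of_rat (q (pe (string_code \<sigma>) k))\<bar> \<le> 1 / 2 ^ k"
    using assms unfolding recursive_martingale_def by blast
  obtain a b c where abc: "recursive a" "recursive b" "recursive c"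
    "\<And>n. q n = (of_nat (a n) - of_nat (b n)) / of_nat (Suc (c n))"
    using q(1) unfolding recursive_rat_seq_def by blast
  \<comment> \<open>Truncated subtraction replaces negative approximations by 0, which is harmless
    as \<open>M\<close> is nonnegative; precision \<open>l\<close> makes the error at most 1 after
    scaling by \<open>2 ^ l\<close>.\<close>
  define z where "z l v = (2 ^ l * (a (pe (string_code (bits l v)) l) - b (pe (string_code (bits l v)) l)))
      div Suc (c (pe (string_code (bits l v)) l))" for l v
  have z: "real (z l v) \<le> 2 ^ l * M (bits l v) + 1 \<and> 2 ^ l * M (bits l v) - 2 \<le> real (z l v)" for l v
  proof -
    let ?n = "pe (string_code (bits l v)) l"
    define y where "y = 2 ^ l * real_of_rat (q ?n)"
    have y_eq: "y = 2 ^ l * (real (a ?n) - real (b ?n)) / real (Suc (c ?n))"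
      unfolding y_def abc(4) by (simp add: of_rat_divide of_rat_diff del: of_nat_Suc)
    have M0: "0 \<le> M (bits l v)" using M by (simp add: martingale_def)
    have "\<bar>2 ^ l * M (bits l v) - y\<bar> = 2 ^ l * \<bar>M (bits l v) - real_of_rat (q ?n)\<bar>"
      unfolding y_def right_diff_distrib[symmetric] abs_mult by simp
    also have "\<dots> \<le> 2 ^ l * (1 / 2 ^ l)" by (intro mult_left_mono q(2)) simp
    finally have y: "\<bar>2 ^ l * M (bits l v) - y\<bar> \<le> 1" by simp
    show ?thesis
    proof (cases "b ?n \<le> a ?n")
      case True
      then have "y = real (2 ^ l * (a ?n - b ?n)) / real (Suc (c ?n))" by (simp add: y_eq of_nat_diff)
      then have "real (z l v) \<le> y" "y - real (z l v) \<le> 1"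
        unfolding z_def using div_bounds[of "Suc (c ?n)" "2 ^ l * (a ?n - b ?n)"] by simp_all
      then show ?thesis using y by linarith
    next
      case False
      then have "z l v = 0" by (simp add: z_def)
      moreover have "y \<le> 0" unfolding y_eq using False
        by (intro divide_nonpos_nonneg mult_nonneg_nonpos) simp_all
      moreover have "0 \<le> 2 ^ l * M (bits l v)" using M0 by simp
      ultimately show ?thesis using y by simp
    qed
  qed
  show thesis
  proof (rule that[of "\<lambda>n. z (pfst n) (psnd n) + 5"])
    show "recursive (\<lambda>n. z (pfst n) (psnd n) + 5)"
      unfolding z_def by (intro rec_intros abc(1-3)[THEN recursive_comp])
    show "2 ^ l * M (bits l v) \<le> real (z (pfst (pe l v)) (psnd (pe l v)) + 5)" for l v
      using z[of l v] by simp
    fix l v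
    have M2: "M (bits l v) * 2 = M (bits (Suc l) (2 * v)) + M (bits (Suc l) (2 * v + 1))"
      using M bits_child[of l v False] bits_child[of l v True] by (simp add: martingale_def)
    have "2 ^ Suc l * M (bits (Suc l) (2 * v)) + 2 ^ Suc l * M (bits (Suc l) (2 * v + 1)) = 4 * (2 ^ l * M (bits l v))"
      unfolding distrib_left[symmetric] M2[symmetric] by simp
    then have "real (z (Suc l) (2 * v)) + real (z (Suc l) (2 * v + 1)) \<le> 4 * real (z l v) + 10"
      using z[of l v] z[of "Suc l" "2 * v"] z[of "Suc l" "2 * v + 1"] by linarith
    then show "z (pfst (pe (Suc l) (2 * v))) (psnd (pe (Suc l) (2 * v))) + 5 +
        (z (pfst (pe (Suc l) (2 * v + 1))) (psnd (pe (Suc l) (2 * v + 1))) + 5)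
      \<le> 4 * (z (pfst (pe l v)) (psnd (pe l v)) + 5)" by simp
  qed
qed

text \<open>Let \<open>d\<close> majorise a recursive martingale. As \<open>u\<close> dominates the
  time needed to compute \<open>d\<close> on a whole block, some index of \<open>d\<close> is
  counted in every block from its own number on, and the bound on the total capital bounds the
  martingale.\<close>

lemma apath_computably_random:
  assumes dom: "\<And>d. recursive d \<Longrightarrow> \<exists>m0. \<forall>m\<ge>m0. d m \<le> u m"
  shows "computably_random (pathseq limval (active u))"
  unfolding computably_random_def
proof (rule notI, elim exE conjE)
  let ?X = "pathseq limval (active u)"
  fix M assume M: "recursive_martingale M" and succ: "succeeds_on M ?X"
  obtain d where d: "recursive d" "\<And>l v. 2 ^ l * M (bits l v) \<le> real (d (pe l v))"
    "\<And>l v. d (pe (Suc l) (2 * v)) + d (pe (Suc l) (2 * v + 1)) \<le> 4 * d (pe l v)"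
    using recursive_martingale_majorant[OF M] by metis
  obtain i where i: "\<And>x. \<exists>t. conv i x t" "\<And>x t. conv i x t \<Longrightarrow> val i x t = d x"
    using index[OF d(1)] by metis
  define \<tau> where "\<tau> m = (\<Sum>l\<le>2 ^ Suc m. \<Sum>v<2 ^ l. ctime i (pe l v))" for m
  have "recursive \<tau>" unfolding \<tau>_def
    by (intro rec_intros recursive_ctime[OF i(1), THEN recursive_comp])
  then obtain m0 where m0: "\<And>m. m \<ge> m0 \<Longrightarrow> \<tau> m \<le> u m" using dom by blast
  \<comment> \<open>A large second component gives an index of the same function that enters only
    where \<open>u\<close> already exceeds \<open>\<tau>\<close>, and with initial capital below
    \<open>2 ^ n\<close>.\<close>
  define n where "n = pe i (max m0 (d (pe 0 0)))"
  have n: "pfst n = i" "m0 \<le> n" "d (pe 0 0) \<le> n"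
    unfolding n_def using le_prod_encode_2[of "max m0 (d (pe 0 0))" i] by simp_all
  have good: "good n m (u m)" if "n \<le> m" for m
  proof -
    have c: "conv i (pe l v) (u m)" if "l \<le> 2 ^ Suc m" "v < 2 ^ l" for l v
    proof -
      have "ctime i (pe l v) \<le> (\<Sum>v<2 ^ l. ctime i (pe l v))"
        using that by (intro member_le_sum) auto
      also have "\<dots> \<le> \<tau> m" unfolding \<tau>_def
        using that by (intro member_le_sum[of l "{..2 ^ Suc m}" "\<lambda>l. \<Sum>v<2 ^ l. ctime i (pe l v)"]) auto
      also have "\<dots> \<le> u m" using m0 n(2) \<open>n \<le> m\<close> by simp
      finally show ?thesis using conv_mono[OF conv_ctime[OF i(1)]] by blast
    qed
    have "d (pe 0 0) \<le> 2 ^ n" using n(3) less_exp[of n] by linarith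
    then show ?thesis unfolding good_def n(1) using c i(2) d(3) by simp
  qed
  have lim: "limval n l v = d (pe l v)" for l v
    unfolding limval_def n(1) by (rule i(2)[OF conv_ctime[OF i(1)]])
  have bound: "M (restr ?X l) \<le> 2 * 2 ^ wexp n" if l: "2 ^ n \<le> l" for l
  proof -
    define m where "m = blk l"
    have l': "l < 2 ^ Suc m" unfolding m_def by (rule less_exp_blk)
    then have "(2::nat) ^ n < 2 ^ Suc m" using l by simp
    then have nm: "n \<le> m" by (simp only: power_strict_increasing_iff)
    have "2 ^ m \<le> l"
    proof (cases m)
      case 0 then show ?thesis using le_trans[OF one_le_power[of "2::nat" n] l] by simp
    next
      case (Suc k)
      have "\<not> l < 2 ^ Suc k" using not_less_Least[of k "\<lambda>m. l < 2 ^ Suc m"] Suc unfolding m_def blk_def by simp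
      then show ?thesis using Suc by simp
    qed
    then obtain r where r: "l = 2 ^ m + r" using le_Suc_ex by blast
    have "r \<le> 2 ^ m" using l' r by simp
    have act: "active u m n" unfolding active_def using nm good by blast
    have "real (limval n l (apath u l)) / 2 ^ l / 2 ^ wexp n =
      (if active u m n then real (limval n l (apath u l)) / 2 ^ l / 2 ^ wexp n else 0)" using act by simp
    also have "\<dots> \<le> capital limval (active u m) m l (apath u l)" unfolding capital_def using nm
      by (intro member_le_sum[of n "{..m}" "\<lambda>n. if active u m n then real (limval n l (apath u l)) / 2 ^ l / 2 ^ wexp n else 0"]) auto
    also have "\<dots> \<le> 2 - 1 / 2 ^ m" unfolding r by (rule active_capital[OF \<open>r \<le> 2 ^ m\<close>])
    also have "\<dots> \<le> 2" by simp
    finally have le: "real (limval n l (apath u l)) / 2 ^ l / 2 ^ wexp n \<le> 2" .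
    have "2 ^ l * M (restr ?X l) \<le> real (limval n l (apath u l))"
      unfolding restr_pathseq lim by (rule d(2))
    then have "M (restr ?X l) \<le> real (limval n l (apath u l)) / 2 ^ l"
      by (simp add: pos_le_divide_eq mult.commute)
    also have "\<dots> \<le> 2 * 2 ^ wexp n" using le by (simp add: pos_divide_le_eq mult_ac)
    finally show ?thesis .
  qed
  have "limsup (\<lambda>l. ereal (M (restr ?X l))) \<le> ereal (2 * 2 ^ wexp n)"
    by (intro Limsup_bounded eventually_sequentiallyI[of "2 ^ n"]) (use bound in simp)
  then show False using succ by (simp add: succeeds_on_def)
qed

end

section \<open>Failure of Schnorr randomness\<close>

lemma lpath_div_power: "lpath D S (k + r) div 2 ^ r = lpath D S k"
proof (induction r)
  case (Suc r)
  have "lpath D S (k + Suc r) div 2 = lpath D S (k + r)"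
    unfolding add_Suc_right lpath_Suc_pathseq by (cases "pathseq D S (k + r)") simp_all
  then show ?case using Suc by (simp add: div_mult2_eq)
qed simp

context enumeration
begin

text \<open>
  The continuation of the string \<open>w\<close> of length \<open>2 ^ m\<close> if, among the indices convergent by stage \<open>t\<close>,
  those in the finite set coded by \<open>f\<close> are active in block \<open>m\<close>.
\<close>

definition cont :: "nat \<Rightarrow> nat \<Rightarrow> nat \<Rightarrow> nat \<Rightarrow> nat \<Rightarrow> nat" where
  "cont t m f w r = rec_nat w (\<lambda>r y. 2 * y + of_bool
     (over (\<lambda>n k v. val (pfst n) (pe k v) t) (\<lambda>n. odd (f div 2 ^ n) \<and> good n m t) m (Suc (2 ^ m + r)) (2 * y))) r"

lemma cont_0 [simp]: "cont t m f w 0 = w"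
  and cont_Suc: "cont t m f w (Suc r) = 2 * cont t m f w r + of_bool
     (over (\<lambda>n k v. val (pfst n) (pe k v) t) (\<lambda>n. odd (f div 2 ^ n) \<and> good n m t) m
       (Suc (2 ^ m + r)) (2 * cont t m f w r))"
  by (simp_all add: cont_def)

text \<open>Within a block the path depends only on the string at its start and on the set of active
  indices, whose code is the required \<open>f\<close>. Stage \<open>t\<close> suffices because
  active indices are \<open>good\<close> by stage \<open>u m\<close>.\<close>

lemma cont_apath:
  assumes "u m \<le> t"
  shows "\<exists>f<2 ^ Suc m. \<forall>r\<le>2 ^ m. cont t m f (apath u (2 ^ m)) r = apath u (2 ^ m + r)"
proof -
  let ?A = "{n. n \<le> m \<and> active u m n}"
  define f where "f = set_encode ?A"
  have f: "f < 2 ^ Suc m" unfolding f_def by (rule set_encode_less) auto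
  have "set_decode f = ?A" unfolding f_def by (rule set_encode_inverse) auto
  then have odd: "odd (f div 2 ^ n) \<longleftrightarrow> n \<le> m \<and> active u m n" for n
    unfolding set_decode_def by blast
  have good: "good n m t" if "active u m n" for n
    using that good_mono[OF _ assms] by (auto simp: active_def)
  have "cont t m f (apath u (2 ^ m)) r = apath u (2 ^ m + r)" if "r \<le> 2 ^ m" for r
    using that
  proof (induction r)
    case (Suc r)
    let ?l = "2 ^ m + r"
    have b: "blk ?l = m" "?l \<noteq> 0" using Suc.prems by (auto intro!: blk_eq)
    have less: "2 * apath u ?l < 2 ^ Suc ?l" using lpath_less[of limval "active u" ?l] by simp
    have "over (\<lambda>n k v. val (pfst n) (pe k v) t) (\<lambda>n. odd (f div 2 ^ n) \<and> good n m t) m (Suc ?l) (2 * apath u ?l)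
      = over limval (active u m) m (Suc ?l) (2 * apath u ?l)"
    proof (rule over_cong)
      show "n \<le> m \<Longrightarrow> (odd (f div 2 ^ n) \<and> good n m t) = active u m n" for n
        using odd good by blast
      fix n assume "odd (f div 2 ^ n) \<and> good n m t"
      then show "val (pfst n) (pe (Suc ?l) (2 * apath u ?l)) t = limval n (Suc ?l) (2 * apath u ?l)"
        using good_limval[OF _ _ less, of n m t] Suc.prems by simp
    qed
    then show ?case using Suc b by (simp add: cont_Suc)
  qed simp
  then show ?thesis using f by blast
qed

lemma recursive_cont:
  assumes "recursive a" "recursive b" "recursive c" "recursive d" "recursive e"
  shows "recursive (\<lambda>x. cont (a x) (b x) (c x) (d x) (e x))"
  unfolding cont_def over_def by (intro rec_intros assms assms[THEN recursive_comp])

text \<open>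
  In block \<open>m\<close> the martingale spreads its capital evenly over the \<open>2 ^ Suc m\<close> continuations given
  by \<open>cont\<close>. Truncated subtraction covers the strings ending before the block.
\<close>

definition hits :: "nat \<Rightarrow> nat \<Rightarrow> nat \<Rightarrow> nat \<Rightarrow> nat" where
  "hits t m l v = (\<Sum>f<2 ^ Suc m. of_bool (cont t m f (v div 2 ^ (l - 2 ^ m)) (min (l - 2 ^ m) (2 ^ m)) =
     v div 2 ^ (l - 2 ^ m - min (l - 2 ^ m) (2 ^ m))))"

text \<open>Each continuation starts with the share \<open>1 / 2 ^ Suc m\<close>, doubled at each
  bit of the block; the exponent stays fixed afterwards.\<close>

definition gain :: "nat \<Rightarrow> nat \<Rightarrow> nat \<Rightarrow> nat \<Rightarrow> real" where
  "gain t m l v = real (hits t m l v) * 2 ^ min (l - 2 ^ m) (2 ^ m) / 2 ^ Suc m"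

lemma gain_before: "l \<le> 2 ^ m \<Longrightarrow> gain t m l v = 1"
  by (simp add: gain_def hits_def)

text \<open>Inside the block each continuation prescribes exactly one next bit, so the hits are
  divided between the children while the stake doubles; outside it no bet is made.\<close>

lemma gain_martingale: "gain t m (Suc l) (2 * v) + gain t m (Suc l) (2 * v + 1) = 2 * gain t m l v"
proof -
  consider "l < 2 ^ m" | "2 ^ m \<le> l" "l < 2 ^ Suc m" | "2 ^ Suc m \<le> l" by linarith
  then show ?thesis
  proof cases
    case 1
    then show ?thesis by (simp add: gain_before)
  next
    case 2
    define k where "k = l - 2 ^ m"
    have k: "Suc l - 2 ^ m = Suc k" "k < 2 ^ m" using 2 by (auto simp: k_def)
    have w: "(2 * v) div 2 ^ Suc k = v div 2 ^ k" "(2 * v + 1) div 2 ^ Suc k = v div 2 ^ k"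
      by (simp_all add: div_mult2_eq)
    have "hits t m (Suc l) (2 * v) + hits t m (Suc l) (2 * v + 1) = hits t m l v"
      unfolding hits_def k(1) w k_def[symmetric] sum.distrib[symmetric]
    proof (intro sum.cong refl)
      fix f
      let ?c = "cont t m f (v div 2 ^ k) k"
      have "of_bool (cont t m f (v div 2 ^ k) (Suc k) = 2 * v) +
          of_bool (cont t m f (v div 2 ^ k) (Suc k) = 2 * v + 1) = (of_bool (?c = v) :: nat)"
        unfolding cont_Suc by (auto simp: of_bool_def split: if_splits)
      then show "of_bool (cont t m f (v div 2 ^ k) (min (Suc k) (2 ^ m)) = 2 * v div 2 ^ (Suc k - min (Suc k) (2 ^ m))) +
          of_bool (cont t m f (v div 2 ^ k) (min (Suc k) (2 ^ m)) = (2 * v + 1) div 2 ^ (Suc k - min (Suc k) (2 ^ m))) =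
          (of_bool (cont t m f (v div 2 ^ k) (min k (2 ^ m)) = v div 2 ^ (k - min k (2 ^ m))) :: nat)"
        using k(2) by (simp add: min_absorb1)
    qed
    then have h: "real (hits t m (Suc l) (2 * v)) + real (hits t m (Suc l) (2 * v + 1)) = real (hits t m l v)"
      by (simp flip: of_nat_add)
    have "gain t m (Suc l) (2 * v) + gain t m (Suc l) (2 * v + 1) =
      (real (hits t m (Suc l) (2 * v)) + real (hits t m (Suc l) (2 * v + 1))) * 2 ^ Suc k / 2 ^ Suc m"
      unfolding gain_def k(1) using k(2) by (simp add: min_absorb1 add_divide_distrib distrib_right)
    also have "\<dots> = 2 * gain t m l v"
      unfolding h unfolding gain_def k_def[symmetric] using k(2) by (simp add: min_absorb1)
    finally show ?thesis .
  next
    case 3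
    define k where "k = l - 2 ^ m"
    have k: "Suc l - 2 ^ m = Suc k" "2 ^ m \<le> k" using 3 by (auto simp: k_def)
    have j: "Suc k - 2 ^ m = Suc (k - 2 ^ m)" using k by simp
    have w: "(2 * v) div 2 ^ Suc j = v div 2 ^ j" "(2 * v + 1) div 2 ^ Suc j = v div 2 ^ j" for j
      by (simp_all add: div_mult2_eq)
    have "hits t m (Suc l) (2 * v) = hits t m l v" "hits t m (Suc l) (2 * v + 1) = hits t m l v"
      unfolding hits_def k(1) k_def[symmetric] using k(2) j w by (simp_all add: min_absorb2 del: power_Suc)
    then show ?thesis unfolding gain_def k(1) k_def[symmetric] using k(2) by (simp add: min_absorb2)
  qed
qed

text \<open>If \<open>u m \<le> p m\<close>, the path follows one of the \<open>2 ^ Suc m\<close>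
  continuations computed with stage \<open>p m\<close>, and the share of that one grows by the
  factor \<open>2 ^ 2 ^ m\<close>. The weights \<open>1 / 2 ^ m\<close> combine all blocks.\<close>

lemma apath_not_schnorr:
  assumes p: "recursive p" and inf: "\<And>b. \<exists>m\<ge>b. u m \<le> p m"
  shows "\<not> schnorr_random (pathseq limval (active u))"
proof -
  let ?X = "pathseq limval (active u)"
  \<comment> \<open>The exponents produce the common denominator \<open>2 ^ (2 * l + 1)\<close>, as
    \<open>2 * l + 1 = 2 * (l - m) + (Suc m + m)\<close>.\<close>
  define e where "e m l v = hits (p m) m l v * 2 ^ (min (l - 2 ^ m) (2 ^ m) + 2 * (l - m))" for m l v
  define a where "a l v = (\<Sum>m<l. e m l v) + 2 ^ (l + 2)" for l v
  \<comment> \<open>The martingales with \<open>m \<ge> length \<sigma>\<close> have not started and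
    have capital 1; the last term is the sum of their weights.\<close>
  define M where "M \<sigma> = (\<Sum>m<length \<sigma>. gain (p m) m (length \<sigma>) (strval \<sigma>) / 2 ^ m) + 2 / 2 ^ length \<sigma>" for \<sigma>
  have a_rec: "recursive (\<lambda>x. a (f x) (g x))" if "recursive f" "recursive g" for f g
    unfolding a_def e_def hits_def
    by (intro rec_intros recursive_cont that that[THEN recursive_comp] p[THEN recursive_comp])
  have M_eq: "M \<sigma> = real (a (length \<sigma>) (strval \<sigma>)) / 2 ^ (2 * length \<sigma> + 1)" for \<sigma>
  proof -
    define l v where "l = length \<sigma>" and "v = strval \<sigma>"
    have "real (e m l v) / 2 ^ (2 * l + 1) = gain (p m) m l v / 2 ^ m" if "m < l" for m
    proof -
      have "2 * l + 1 = 2 * (l - m) + (Suc m + m)" using that by simp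
      then have "(2::real) ^ (2 * l + 1) = 2 ^ (2 * (l - m)) * (2 ^ Suc m * 2 ^ m)" by (simp only: power_add)
      then show ?thesis by (simp add: e_def gain_def power_add)
    qed
    moreover have "real (2 ^ (l + 2)) / 2 ^ (2 * l + 1) = 2 / 2 ^ l"
    proof -
      have "2 * l + 1 = l + l + 1" by simp
      then have "(2::real) ^ (2 * l + 1) = 2 ^ l * 2 ^ l * 2" by (simp only: power_add power_one_right)
      then show ?thesis by (simp add: power_add)
    qed
    ultimately have "real (a l v) / 2 ^ (2 * l + 1) = (\<Sum>m<l. gain (p m) m l v / 2 ^ m) + 2 / 2 ^ l"
      by (simp only: a_def of_nat_add of_nat_sum add_divide_distrib sum_divide_distrib) simp
    then show ?thesis by (simp add: M_def l_def v_def)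
  qed
  have nonneg: "0 \<le> M \<sigma>" for \<sigma> unfolding M_eq by simp
  have "M \<sigma> = (M (\<sigma> @ [False]) + M (\<sigma> @ [True])) / 2" for \<sigma>
  proof -
    define l v where "l = length \<sigma>" and "v = strval \<sigma>"
    have "l \<le> 2 ^ l" using less_exp[of l] by (rule less_imp_le)
    have "M (\<sigma> @ [False]) + M (\<sigma> @ [True]) =
      (\<Sum>m<Suc l. gain (p m) m (Suc l) (2 * v) / 2 ^ m + gain (p m) m (Suc l) (2 * v + 1) / 2 ^ m) + 2 * (2 / 2 ^ Suc l)"
      by (simp only: M_def length_append_singleton strval_snoc of_bool_eq sum.distrib add_0_right l_def v_def)
    also have "(\<Sum>m<Suc l. gain (p m) m (Suc l) (2 * v) / 2 ^ m + gain (p m) m (Suc l) (2 * v + 1) / 2 ^ m) =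
      (\<Sum>m<Suc l. 2 * (gain (p m) m l v / 2 ^ m))"
      by (simp only: add_divide_distrib[symmetric] gain_martingale times_divide_eq_right)
    also have "\<dots> = 2 * (\<Sum>m<l. gain (p m) m l v / 2 ^ m) + 2 * (1 / 2 ^ l)"
      by (simp add: gain_before[OF \<open>l \<le> 2 ^ l\<close>] sum_distrib_left)
    finally show ?thesis by (simp add: M_def l_def v_def)
  qed
  then have "martingale M" unfolding martingale_def using nonneg by blast
  then have M: "recursive_martingale M"
    by (intro recursive_martingaleI[of a "\<lambda>l. 2 * l + 1"] a_rec rec_intros M_eq)
  have big: "2 ^ m \<le> M (restr ?X (2 ^ Suc m))" if m: "u m \<le> p m" "4 \<le> m" for m
  proof -
    let ?l = "2 ^ Suc m :: nat"
    let ?v = "apath u ?l"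
    have ml: "m < ?l" by (rule less_exp_Suc)
    have l: "?l - 2 ^ m = 2 ^ m" "2 ^ m + 2 ^ m = ?l" by simp_all
    obtain f where f: "f < 2 ^ Suc m" "\<forall>r\<le>2 ^ m. cont (p m) m f (apath u (2 ^ m)) r = apath u (2 ^ m + r)"
      using cont_apath[of u m "p m", OF m(1)] by blast
    have "?v div 2 ^ 2 ^ m = apath u (2 ^ m)"
      using lpath_div_power[of limval "active u" "2 ^ m" "2 ^ m"] unfolding l(2) .
    moreover have "cont (p m) m f (apath u (2 ^ m)) (2 ^ m) = ?v"
      using f(2)[rule_format, of "2 ^ m"] by (simp only: l(2) le_refl)
    ultimately have "1 = of_bool (cont (p m) m f (?v div 2 ^ (?l - 2 ^ m)) (min (?l - 2 ^ m) (2 ^ m)) =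
       ?v div 2 ^ (?l - 2 ^ m - min (?l - 2 ^ m) (2 ^ m)))" unfolding l(1) by simp
    also have "\<dots> \<le> hits (p m) m ?l ?v" unfolding hits_def using f(1)
      by (intro member_le_sum[of f "{..<2 ^ Suc m}" "\<lambda>f. of_bool (cont (p m) m f (?v div 2 ^ (?l - 2 ^ m))
         (min (?l - 2 ^ m) (2 ^ m)) = ?v div 2 ^ (?l - 2 ^ m - min (?l - 2 ^ m) (2 ^ m)))"]) auto
    finally have h: "1 \<le> hits (p m) m ?l ?v" .
    \<comment> \<open>Splitting \<open>2 ^ 2 ^ m\<close> into \<open>2 ^ Suc m\<close> shares and
      weighting by \<open>1 / 2 ^ m\<close> must leave \<open>2 ^ m\<close>, hence the exponent
      \<open>3 * m + 1\<close>.\<close>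
    have "(2::real) ^ m * (2 ^ Suc m * 2 ^ m) = 2 ^ (3 * m + 1)" by (simp add: power_add[symmetric])
    also have "\<dots> \<le> 2 ^ 2 ^ m" using three_mult_less_exp[OF m(2)] by (intro power_increasing) auto
    also have "\<dots> \<le> real (hits (p m) m ?l ?v) * 2 ^ 2 ^ m" using h by simp
    finally have "2 ^ m \<le> real (hits (p m) m ?l ?v) * 2 ^ 2 ^ m / (2 ^ Suc m * 2 ^ m)"
      by (simp add: pos_le_divide_eq)
    also have "\<dots> = gain (p m) m ?l ?v / 2 ^ m" unfolding gain_def l(1) by simp
    also have "\<dots> \<le> (\<Sum>m<?l. gain (p m) m ?l ?v / 2 ^ m)" using ml
      by (intro member_le_sum[of m "{..<?l}" "\<lambda>m. gain (p m) m ?l ?v / 2 ^ m"]) (auto simp: gain_def)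
    also have "\<dots> \<le> M (restr ?X ?l)"
      unfolding M_def strval_restr_pathseq by (simp add: restr_def)
    finally show ?thesis .
  qed
  have "infinite {n. real (n div 2) \<le> M (restr ?X n)}"
    unfolding infinite_nat_iff_unbounded_le
  proof
    fix b
    obtain m where m: "m \<ge> max b 4" "u m \<le> p m" using inf by blast
    have "real (2 ^ Suc m div 2) \<le> M (restr ?X (2 ^ Suc m))" using big[OF m(2)] m(1) by simp
    moreover have "b \<le> 2 ^ Suc m" using less_exp_Suc[of m] m(1) by linarith
    ultimately show "\<exists>n\<ge>b. n \<in> {n. real (n div 2) \<le> M (restr ?X n)}" by blast
  qed
  moreover have "recursive (\<lambda>n. n div 2)" by (intro rec_intros)
  moreover have "mono (\<lambda>n::nat. n div 2)" by (intro monoI div_le_mono)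
  moreover have "\<exists>n. b \<le> n div 2" for b :: nat by (rule exI[of _ "2 * b"]) simp
  ultimately show ?thesis using M unfolding schnorr_random_def by blast
qed

end

section \<open>Left-r.e. numberings\<close>

text \<open>The condition tested ignores the search variable, so minimisation stops at 0 or
  never.\<close>

lemma partial_recursive_domain:
  assumes "decidable P"
  shows "partial_recursive (\<lambda>x. if P x then Some 0 else None)"
proof -
  have "recursive (\<lambda>z. of_bool (\<not> P (pfst z)))" by (intro rec_intros decidable_comp[OF assms])
  from partial_recursive.mu[OF this[unfolded recursive_def]]
  show ?thesis by (simp add: Least_eq_0 cong: if_cong)
qed

lemma len_eq: "2 ^ m \<le> x \<Longrightarrow> x < 2 ^ Suc m \<Longrightarrow> len x = Suc m"
  using len_le_iff[of x m] len_le_iff[of x "Suc m"] by linarith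

text \<open>
  An increment \<open>k / 2 ^ m\<close> is realised by the first \<open>k\<close> of the \<open>2 ^ (m - 1)\<close> arguments of length \<open>m\<close>.
\<close>

lemma left_re_numberingI:
  assumes v: "\<And>f g. recursive f \<Longrightarrow> recursive g \<Longrightarrow> recursive (\<lambda>x. v (f x) (g x))"
    and v_0: "\<And>e. v e 0 = 0"
    and v_less: "\<And>e s. v e (Suc s) < 2 ^ s"
    and v_Suc: "\<And>e s. 2 * v e s \<le> v e (Suc s)"
    and lim: "\<And>e. (\<lambda>s. real (v e s) / 2 ^ s) \<longlonglongrightarrow> \<beta> e"
  shows "left_re_numbering \<beta>"
proof -
  define P where "P e x \<longleftrightarrow> x \<noteq> 0 \<and>
    x < 2 ^ (len x - 1) + (v e (len x) - 2 * v e (len x - 1))" for e x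
  have dec: "decidable (\<lambda>z. P (pfst z) (psnd z))"
    unfolding P_def by (intro rec_intros v)
  have part: "(\<Sum>x<2 ^ s. if P e x then 1 / 2 ^ len x else 0) = real (v e s) / 2 ^ s" for e s
  proof (induction s)
    case 0
    show ?case by (simp add: P_def v_0)
  next
    case (Suc s)
    define k where "k = v e (Suc s) - 2 * v e s"
    have k: "k \<le> 2 ^ s" using v_less[of e s] by (simp add: k_def)
    have len: "len x = Suc s" if "x \<in> {2 ^ s..<2 ^ Suc s}" for x using that by (intro len_eq) auto
    have un: "{..<(2::nat) ^ Suc s} = {..<2 ^ s} \<union> {2 ^ s..<2 ^ Suc s}" by auto
    have "(\<Sum>x<2 ^ Suc s. if P e x then 1 / 2 ^ len x else 0) = real (v e s) / 2 ^ s +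
        (\<Sum>x\<in>{2 ^ s..<2 ^ Suc s}. if P e x then 1 / 2 ^ len x else 0)"
      unfolding Suc[symmetric] un by (rule sum.union_disjoint) auto
    also have "(\<Sum>x\<in>{2 ^ s..<2 ^ Suc s}. if P e x then 1 / 2 ^ len x else 0) =
        (\<Sum>x\<in>{2 ^ s..<2 ^ s + k}. 1 / 2 ^ Suc s :: real)"
    proof (rule sum.mono_neutral_cong_right)
      show "{2 ^ s..<2 ^ s + k} \<subseteq> {2 ^ s..<2 ^ Suc s}" using k by auto
      show "\<forall>x\<in>{2 ^ s..<2 ^ Suc s} - {2 ^ s..<2 ^ s + k}. (if P e x then 1 / 2 ^ len x else (0::real)) = 0"
        using len by (auto simp: P_def k_def)
      fix x assume x: "x \<in> {2 ^ s..<2 ^ s + k}"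
      then have "x \<in> {2 ^ s..<2 ^ Suc s}" using k by auto
      moreover have "x \<noteq> 0" using x less_le_trans[of 0 "2 ^ s" x] by auto
      ultimately show "(if P e x then 1 / 2 ^ len x else 0) = (1 / 2 ^ Suc s :: real)"
        using x len by (simp add: P_def k_def)
    qed simp
    also have "\<dots> = real k / 2 ^ Suc s" by simp
    also have "real (v e s) / 2 ^ s + real k / 2 ^ Suc s = real (v e (Suc s)) / 2 ^ Suc s"
      using v_Suc[of e s] by (simp add: k_def of_nat_diff add_divide_distrib[symmetric] divide_simps)
    finally show ?case .
  qed
  have sums: "(\<lambda>x. if P e x then 1 / 2 ^ len x else 0) sums \<beta> e" for e
    unfolding sums_def
  proof (rule increasing_tendsto)
    let ?S = "\<lambda>n. \<Sum>x<n. if P e x then 1 / 2 ^ len x else (0::real)"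
    have mono: "?S m \<le> ?S n" if "m \<le> n" for m n using that by (intro sum_mono2) auto
    have "incseq (\<lambda>s. ?S (2 ^ s))" by (intro monoI mono power_increasing) auto
    then have le: "?S (2 ^ s) \<le> \<beta> e" for s using incseq_le[OF _ lim[of e], of s] by (simp only: part)
    show "eventually (\<lambda>n. ?S n \<le> \<beta> e) sequentially"
    proof (rule always_eventually, rule allI)
      fix n :: nat
      have "?S n \<le> ?S (2 ^ n)" by (intro mono less_imp_le less_exp)
      then show "?S n \<le> \<beta> e" using le[of n] by linarith
    qed
    fix y assume "y < \<beta> e"
    then have "eventually (\<lambda>s. y < real (v e s) / 2 ^ s) sequentially"
      using lim[of e] by (rule order_tendstoD(1)[rotated])
    then obtain s where "y < ?S (2 ^ s)" unfolding part eventually_sequentially by blast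
    then have "y < ?S n" if "2 ^ s \<le> n" for n using mono[OF that] by linarith
    then show "eventually (\<lambda>n. y < ?S n) sequentially" by (rule eventually_sequentiallyI)
  qed
  have "((\<lambda>x. 1 / 2 ^ len x) has_sum \<beta> e) {x. P e x}" for e
  proof -
    have "((\<lambda>x. if P e x then 1 / 2 ^ len x else 0) has_sum \<beta> e) UNIV"
    proof (rule norm_summable_imp_has_sum[OF _ sums])
      have "norm (if P e x then 1 / 2 ^ len x else 0 :: real) = (if P e x then 1 / 2 ^ len x else 0)" for x
        by simp
      then show "summable (\<lambda>x. norm (if P e x then 1 / 2 ^ len x else 0 :: real))"
        using sums_summable[OF sums[of e]] by (simp only:)
    qed
    then show ?thesis by (subst has_sum_cong_neutral[where T = UNIV and g = "\<lambda>x. if P e x then 1 / 2 ^ len x else 0"]) auto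
  qed
  moreover have "\<beta> e \<in> {0..1}" for e
  proof -
    have "real (v e s) / 2 ^ s \<le> 1" for s
    proof (cases s)
      case (Suc s')
      have "v e s < 2 ^ s" using v_less[of e s'] Suc by simp
      then show ?thesis by (simp add: less_imp_le)
    qed (simp add: v_0)
    then show ?thesis using LIMSEQ_le_const[OF lim[of e], of 0] LIMSEQ_le_const2[OF lim[of e], of 1] by auto
  qed
  ultimately show ?thesis
    unfolding left_re_numbering_def
    by (intro exI[of _ "\<lambda>z. if P (pfst z) (psnd z) then Some 0 else None"] conjI partial_recursive_domain[OF dec])
      auto
qed

text \<open>The first bit is always 0. The bound is what \<open>left_re_numberingI\<close> demands,
  as only \<open>2 ^ s\<close> arguments have length \<open>Suc s\<close>.\<close>

lemma lpath_Suc_less: "lpath D S (Suc l) < 2 ^ l"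
proof (induction l)
  case (Suc l)
  moreover have "of_bool (pathseq D S (Suc l)) \<le> (1::nat)" by simp
  ultimately show ?case unfolding lpath_Suc_pathseq[of D S "Suc l"] power_Suc[of 2 l] by linarith
qed simp

lemma lpath_tendsto: "(\<lambda>l. real (lpath D S l) / 2 ^ l) \<longlonglongrightarrow> real_of_seq (pathseq D S)"
proof -
  have "real (lpath D S l) / 2 ^ l = (\<Sum>n<l. of_bool (pathseq D S n) / 2 ^ Suc n)" for l
  proof (induction l)
    case (Suc l)
    then show ?case unfolding lpath_Suc_pathseq by (simp add: add_divide_distrib)
  qed simp
  then show ?thesis unfolding real_of_seq_def using summable_LIMSEQ[OF summable_real_of_seq] by simp
qed

lemma power_mult_lpath_le: "2 ^ r * lpath D S k \<le> lpath D S (k + r)"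
  unfolding lpath_div_power[of D S k r, symmetric] by (metis mult.commute div_times_less_eq_dividend)

section \<open>The leftmost paths as a left-r.e. numbering\<close>

context enumeration
begin

text \<open>Stage \<open>s\<close> runs the path with \<open>g e k s\<close> in place of the limits.
  It moves right with \<open>s\<close> by \<open>lpath_mono\<close>, and each prefix of the limit
  path is reached, since it depends on finitely many values of \<open>G e\<close>.\<close>

lemma left_re_numbering_apath:
  assumes g: "\<And>a b c. recursive a \<Longrightarrow> recursive b \<Longrightarrow> recursive c \<Longrightarrow> recursive (\<lambda>x. g (a x) (b x) (c x))"
    and mono: "\<And>e m s t. s \<le> t \<Longrightarrow> g e m s \<le> g e m t"
    and G: "\<And>e m. \<exists>s0. \<forall>s\<ge>s0. g e m s = G e m"
  shows "left_re_numbering (\<lambda>e. real_of_seq (pathseq limval (active (G e))))"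
proof -
  define v where "v e s = apath (\<lambda>k. g e k s) s" for e s
  have le_G: "g e m s \<le> G e m" for e m s
  proof -
    obtain s0 where "\<forall>s\<ge>s0. g e m s = G e m" using G by blast
    then have "g e m (max s s0) = G e m" by simp
    then show ?thesis using mono[of s "max s s0" e m] by simp
  qed
  have apath_mono: "apath u l \<le> apath w l" if "\<And>k. u k \<le> w k" for u w l
    using active_mono that by (intro lpath_mono) blast
  show ?thesis
  proof (rule left_re_numberingI[of v])
    fix f h assume r: "recursive f" "recursive h"
    have "recursive (\<lambda>x. apath ((\<lambda>z k. g (pfst z) k (psnd z)) (pe (f x) (h x))) (h x))"
    proof (rule recursive_apath)
      show "recursive (\<lambda>x. g (pfst (a x)) (b x) (psnd (a x)))" if "recursive a" "recursive b" for a b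
        by (intro rec_intros g that)
    qed (intro rec_intros r)+
    then show "recursive (\<lambda>x. v (f x) (h x))" by (simp add: v_def)
  next
    fix e s
    show "v e 0 = 0" by (simp add: v_def)
    show "v e (Suc s) < 2 ^ s" unfolding v_def by (rule lpath_Suc_less)
    have "2 * v e s \<le> 2 * apath (\<lambda>k. g e k (Suc s)) s"
      unfolding v_def by (intro mult_left_mono apath_mono mono) auto
    also have "\<dots> \<le> v e (Suc s)" unfolding v_def lpath_Suc_pathseq by simp
    finally show "2 * v e s \<le> v e (Suc s)" .
  next
    fix e
    let ?\<beta> = "real_of_seq (pathseq limval (active (G e)))"
    let ?x = "\<lambda>l. real (apath (G e) l) / 2 ^ l"
    have "incseq ?x"
    proof (rule incseq_SucI)
      fix l show "?x l \<le> ?x (Suc l)" unfolding lpath_Suc_pathseq by (simp add: divide_simps)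
    qed
    from incseq_le[OF this lpath_tendsto] have x_le: "?x l \<le> ?\<beta>" for l .
    show "(\<lambda>s. real (v e s) / 2 ^ s) \<longlonglongrightarrow> ?\<beta>"
    proof (rule increasing_tendsto)
      have "real (v e s) / 2 ^ s \<le> ?\<beta>" for s
      proof -
        have "v e s \<le> apath (G e) s" unfolding v_def by (intro apath_mono le_G)
        then have "real (v e s) / 2 ^ s \<le> ?x s" by (intro divide_right_mono) auto
        then show ?thesis using x_le[of s] by linarith
      qed
      then show "eventually (\<lambda>s. real (v e s) / 2 ^ s \<le> ?\<beta>) sequentially" by simp
    next
      fix y assume "y < ?\<beta>"
      then have "eventually (\<lambda>l. y < ?x l) sequentially"
        using lpath_tendsto by (rule order_tendstoD(1)[rotated])
      then obtain l where l: "y < ?x l" unfolding eventually_sequentially by blast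
      have "eventually (\<lambda>s. \<forall>k\<le>l. g e k s = G e k) sequentially"
        using G by (intro eventually_all_le_nat) (simp add: eventually_sequentially)
      moreover have "eventually (\<lambda>s. l \<le> s) sequentially" by (rule eventually_ge_at_top)
      ultimately show "eventually (\<lambda>s. y < real (v e s) / 2 ^ s) sequentially"
      proof eventually_elim
        case (elim s)
        have "apath (\<lambda>k. g e k s) l = apath (G e) l"
          using elim(1) by (intro lpath_cong) (auto simp: active_def)
        moreover obtain r where r: "s = l + r" using elim(2) le_Suc_ex by blast
        ultimately have "2 ^ r * apath (G e) l \<le> v e s"
          using power_mult_lpath_le[of r limval "active (\<lambda>k. g e k s)" l] by (simp add: v_def)
        then have "real (2 ^ r * apath (G e) l) / 2 ^ s \<le> real (v e s) / 2 ^ s"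
          by (intro divide_right_mono) (simp_all only: of_nat_le_iff zero_le_power zero_le_numeral)
        moreover have "real (2 ^ r * apath (G e) l) / 2 ^ s = ?x l" by (simp add: r power_add)
        ultimately show ?case using l by linarith
      qed
    qed
  qed
qed

end

section \<open>Reduction of the given set to the constructed numbering\<close>

theorem theorem5p8:
  fixes \<alpha> :: "nat \<Rightarrow> real" and A :: "nat set"
  assumes "left_re_numbering \<alpha>" and "universal_numbering \<alpha>" and "acceptable_numbering \<alpha>"
    and "Pi_set 4 A"
  shows "\<exists>f. recursive f \<and>
    (\<forall>e. (e \<in> A \<longrightarrow> computably_random_real (\<alpha> (f e))) \<and>
         (e \<notin> A \<longrightarrow> \<not> schnorr_random_real (\<alpha> (f e))))"
proof -
  obtain chk where "\<And>f g h. recursive f \<Longrightarrow> recursive g \<Longrightarrow> recursive h \<Longrightarrow> decidable (\<lambda>x. chk (f x) (g x) (h x))"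
    "\<And>d. recursive d \<Longrightarrow> \<exists>c. \<forall>x. (\<exists>s. chk c x s) \<and> (\<forall>s. chk c x s \<longrightarrow> pfst s = d x)"
    by (rule universal_enumeration[OF assms(1,2)]) blast
  then interpret enumeration chk by unfold_locales
  obtain g where g: "\<And>a b c. recursive a \<Longrightarrow> recursive b \<Longrightarrow> recursive c \<Longrightarrow> recursive (\<lambda>x. g (a x) (b x) (c x))"
    "\<And>e m s t. s \<le> t \<Longrightarrow> g e m s \<le> g e m t"
    "\<And>e m. \<exists>B. \<forall>s. g e m s \<le> B"
    "\<And>e d. e \<in> A \<Longrightarrow> recursive d \<Longrightarrow> \<exists>m0. \<forall>m\<ge>m0. \<exists>s. d m \<le> g e m s"
    "\<And>e. e \<notin> A \<Longrightarrow> \<exists>p. recursive p \<and> (\<forall>b. \<exists>m\<ge>b. \<forall>s. g e m s \<le> p m)"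
    by (rule dominating_approximation[OF assms(4)]) blast
  define G where "G e m = Max (range (g e m))" for e m
  have fin: "finite (range (g e m))" for e m
  proof -
    obtain B where "\<forall>s. g e m s \<le> B" using g(3) by blast
    then have "range (g e m) \<subseteq> {..B}" by auto
    then show ?thesis by (rule finite_subset) simp
  qed
  have le_G: "g e m s \<le> G e m" for e m s unfolding G_def using fin by (intro Max_ge) auto
  have G_in: "\<exists>s. G e m = g e m s" for e m
  proof -
    have "G e m \<in> range (g e m)" unfolding G_def using fin by (intro Max_in) auto
    then show ?thesis by blast
  qed
  have G: "\<exists>s0. \<forall>s\<ge>s0. g e m s = G e m" for e m
    using G_in[of e m] g(2)[of _ _ e m] le_G[of e m] by (metis le_antisym)
  have "left_re_numbering (\<lambda>e. real_of_seq (pathseq limval (active (G e))))"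
    by (rule left_re_numbering_apath[of g]) (fact g(1) g(2) G)+
  then obtain f where f: "recursive f" "\<And>e. \<alpha> (f e) = real_of_seq (pathseq limval (active (G e)))"
    using assms(3) unfolding acceptable_numbering_def by blast
  have "computably_random_real (\<alpha> (f e))" if "e \<in> A" for e
  proof -
    have "\<exists>m0. \<forall>m\<ge>m0. d m \<le> G e m" if "recursive d" for d
    proof -
      obtain m0 where "\<forall>m\<ge>m0. \<exists>s. d m \<le> g e m s" using g(4)[OF \<open>e \<in> A\<close> \<open>recursive d\<close>] by blast
      then have "\<forall>m\<ge>m0. d m \<le> G e m" by (meson le_G le_trans)
      then show ?thesis by blast
    qed
    then have "computably_random (pathseq limval (active (G e)))" by (rule apath_computably_random)
    then show ?thesis unfolding computably_random_real_def f(2) by blast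
  qed
  moreover have "\<not> schnorr_random_real (\<alpha> (f e))" if "e \<notin> A" for e
  proof -
    obtain p where p: "recursive p" "\<And>b. \<exists>m\<ge>b. \<forall>s. g e m s \<le> p m" using g(5)[OF \<open>e \<notin> A\<close>] by blast
    have "\<exists>m\<ge>b. G e m \<le> p m" for b using p(2)[of b] G_in[of e] by (metis (no_types))
    from apath_not_schnorr[OF p(1) this] have ns: "\<not> schnorr_random (pathseq limval (active (G e)))" .
    have "\<not> schnorr_random X" if "real_of_seq X = real_of_seq (pathseq limval (active (G e)))" for X
    proof (cases "X = pathseq limval (active (G e))")
      case False
      then show ?thesis using two_expansions_constant[OF that] eventually_constant_not_schnorr by blast
    qed (use ns in simp)
    then show ?thesis unfolding schnorr_random_real_def f(2) by blast
  qed
  ultimately show ?thesis using f(1) by blast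
qed

end
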